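(* Let $\mathsf{X}$, $\mathsf{Y}$, $\mu_x$, $\mu_y$, $f$, the group $G$ acting on $\mathsf Y$, the function $j$, and left-Haar measure $\nu_l$ be as specified in the context. Suppose that $\nu_l(G)=\infty$ and that $m(y)=\int_G f_Y(gy)j(g,y)\,\nu_l(dg)$ is positive for all $y\in\mathsf Y$ and finite for $\mu_y$-almost all $y\in\mathsf Y$. Put $\overline{\mathsf Y}=\{y\in\mathsf Y:m(y)<\infty\}$ and $\hat f(x,y,g)=f(x,gy)\,j(g,y)$. Then $$\int_G\int_{\mathsf Y}\int_{\mathsf X}\hat f(x,y,g)\,\mu_x(dx)\,\mu_y(dy)\,\nu_l(dg)=\nu_l(G)=\infty,$$ so $\hat f$ cannot be normalized to a probability density with respect to $\mu_x\times\mu_y\times\nu_l$. Nevertheless, define formally the "conditional" densities $$\hat f(y|x,g)=\frac{\hat f(x,y,g)}{\int_{\mathsf Y}\hat f(x,y,g)\mu_y(dy)}=f_{Y|X}(gy|x)\,j(g,y),$$ $$\hat f(x,g|y)=\frac{\hat f(x,y,g)}{\int_G\int_{\mathsf X}\hat f(x,y,g)\mu_x(dx)\nu_l(dg)}=\frac{f(x,gy)\,j(g,y)}{m(y)}\quad (y\in\overline{\mathsf Y}),$$ and $$p^*((x,g)|(x',g'))=\int_{\overline{\mathsf Y}} \hat f(x,g|y)\,\hat f(y|x',g')\,\mu_y(dy),$$ which is a Markov transition density on $\mathsf X\times G$ with respect to $\mu_x\times\nu_l$. Let $\{(X_n,G_n)\}_{n=0}^\infty$ be the corresponding Markov chain.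 Then: (a) The measure $f_X(x)\mu_x(dx)\nu_l(dg)$ is invariant for $\{(X_n,G_n)\}_{n=0}^\infty$; its total mass is $\nu_l(G)=\infty$, and hence the chain $\{(X_n,G_n)\}_{n=0}^\infty$ cannot be positive recurrent. (b) The conditional density (with respect to $\mu_x$) of $X_{n+1}$ given $(X_n,G_n)=(x',g')$ is $$\int_G p^*((x,g)|(x',g'))\,\nu_l(dg)=p^*(x|x'),$$ which does not depend on $g'$, where $$p^*(x|x')=\int_{\mathsf Y}\int_{\mathsf Y} f_{X|Y}(x|y')\,Q(y,dy')\,f_{Y|X}(y|x')\,\mu_y(dy).$$ Consequently $\{X_n\}_{n=0}^\infty$ is itself a Markov chain, namely the one driven by the Markov transition density $p^*(x|x')$. Thus the Markov chain with transition density $p^*(x|x')$ (the general Haar PX-DA chain) is a marginal Markov chain of a nonpositive recurrent chain on the larger space $\mathsf X\times G$.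
   Context: Setting: $\mathsf{X}$ and $\mathsf{Y}$ are locally compact, separable metric spaces with Borel $\sigma$-algebras and $\sigma$-finite measures $\mu_x,\mu_y$; $f(x,y)$ is a probability density on $\mathsf X\times\mathsf Y$ with respect to $\mu_x\times\mu_y$, with marginals $f_X(x)=\int_{\mathsf Y} f(x,y)\mu_y(dy)$, $f_Y(y)=\int_{\mathsf X} f(x,y)\mu_x(dx)$ and conditionals $f_{X|Y}(x|y)=f(x,y)/f_Y(y)$, $f_{Y|X}(y|x)=f(x,y)/f_X(x)$ (on the null sets where a denominator is not in $(0,\infty)$, some fixed probability density). Equalities between densities are understood almost everywhere. Group structure: $G$ is a locally compact, separable metric space that is also a topological group with identity $e$, acting topologically on the left of $\mathsf Y$: there is a continuous map $G\times\mathsf Y\to\mathsf Y$, $(g,y)\mapsto gy$, with $ey=y$ and $(g_1g_2)y=g_1(g_2y)$. There is a (measurable) function $j:G\times\mathsf Y\to(0,\infty)$ such that: (1) $j(g^{-1},y)=1/j(g,y)$ for all $g,y$; (2) $j(g_1g_2,y)=j(g_1,g_2y)\,j(g_2,y)$ for all $g_1,g_2,y$; (3) for all $g\in G$ and all integrable $h:\mathsf Y\to\mathbb R$, $\int_{\mathsf Y}h(gy)j(g,y)\mu_y(dy)=\int_{\mathsf Y}h(y)\mu_y(dy)$. $\nu_l$ is a left-Haar measure on $G$, i.e. a nontrivial measure with $\int_G h(\tilde g g)\nu_l(dg)=\int_G h(g)\nu_l(dg)$ for all $\tilde g\in G$ and all integrable $h:G\to\mathbb R$. $Q$ is the Markov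 transition function on $\mathsf Y$ defined as follows: for $y\in\overline{\mathsf Y}$, $Q(y,\cdot)$ is the distribution of $gy$ where $g$ has density $f_Y(gy)j(g,y)/m(y)$ on $G$ with respect to $\nu_l$; for $y\notin\overline{\mathsf Y}$, $Q(y,\cdot)$ is the distribution with density $f_Y$ with respect to $\mu_y$. Positive recurrence is in the usual sense of general state space Markov chain theory (an irreducible chain that admits an invariant probability measure). *)

theory Defs
  imports "HOL-Probability.Probability"
begin

section \<open>Densities, transition kernels and Markov chains\<close>

definition prob_density :: "'a measure \<Rightarrow> ('a \<Rightarrow> real) \<Rightarrow> bool" where
  "prob_density M p \<longleftrightarrow>
     p \<in> borel_measurable M \<and> (\<forall>x\<in>space M. 0 \<le> p x) \<and> (\<integral>\<^sup>+x. ennreal (p x) \<partial>M) = 1"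

text \<open>Throughout, the conditioning argument comes second: \<open>p z z'\<close> stands for \<open>p(z|z')\<close>.
  Derived densities take values in \<open>[0,\<infinity>]\<close>, because they may be infinite on null sets.\<close>

definition transition_density :: "'s measure \<Rightarrow> ('s \<Rightarrow> 's \<Rightarrow> ennreal) \<Rightarrow> bool" where
  "transition_density M p \<longleftrightarrow>
     (\<lambda>(z, z'). p z z') \<in> borel_measurable (M \<Otimes>\<^sub>M M) \<and>
     (\<forall>z'\<in>space M. (\<integral>\<^sup>+z. p z z' \<partial>M) = 1)"

definition density_kernel :: "'s measure \<Rightarrow> ('s \<Rightarrow> 's \<Rightarrow> ennreal) \<Rightarrow> 's \<Rightarrow> 's measure" where
  "density_kernel M p z' = density M (\<lambda>z. p z z')"

primrec kernel_power :: "('s \<Rightarrow> 's measure) \<Rightarrow> nat \<Rightarrow> 's \<Rightarrow> 's set \<Rightarrow> ennreal" where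
  "kernel_power K 0 z A = indicator A z"
| "kernel_power K (Suc n) z A = (\<integral>\<^sup>+w. kernel_power K n w A \<partial>K z)"

definition invariant_measure :: "'s measure \<Rightarrow> ('s \<Rightarrow> 's measure) \<Rightarrow> 's measure \<Rightarrow> bool" where
  "invariant_measure S K \<rho> \<longleftrightarrow>
     sets \<rho> = sets S \<and> (\<forall>A\<in>sets S. (\<integral>\<^sup>+z. emeasure (K z) A \<partial>\<rho>) = emeasure \<rho> A)"

text \<open>Irreducibility is irreducibility with respect to some nonzero \<open>\<sigma>\<close>-finite measure,
  as is usual on general state spaces.\<close>

definition irreducible_kernel :: "'s measure \<Rightarrow> ('s \<Rightarrow> 's measure) \<Rightarrow> bool" where
  "irreducible_kernel S K \<longleftrightarrow>
     (\<exists>\<phi>. sigma_finite_measure \<phi> \<and> sets \<phi> = sets S \<and> emeasure \<phi> (space \<phi>) \<noteq> 0 \<and>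
        (\<forall>z\<in>space S. \<forall>A\<in>sets S. emeasure \<phi> A > 0 \<longrightarrow> (\<exists>n\<ge>1. kernel_power K n z A > 0)))"

definition positive_recurrent :: "'s measure \<Rightarrow> ('s \<Rightarrow> 's measure) \<Rightarrow> bool" where
  "positive_recurrent S K \<longleftrightarrow>
     irreducible_kernel S K \<and> (\<exists>\<pi>. prob_space \<pi> \<and> invariant_measure S K \<pi>)"

definition history :: "'w measure \<Rightarrow> 's measure \<Rightarrow> (nat \<Rightarrow> 'w \<Rightarrow> 's) \<Rightarrow> nat \<Rightarrow> 'w measure" where
  "history M S Z n = sigma (space M) (\<Union>i\<le>n. {Z i -` A \<inter> space M | A. A \<in> sets S})"

text \<open>A process on \<open>M\<close>, with arbitrary initial distribution, that satisfies
  \<open>P(Z\<^sub>n\<^sub>+\<^sub>1 \<in> A | Z\<^sub>0, \<dots>, Z\<^sub>n) = K(Z\<^sub>n, A)\<close> almost surely.\<close>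

definition markov_chain ::
  "'w measure \<Rightarrow> 's measure \<Rightarrow> ('s \<Rightarrow> 's measure) \<Rightarrow> (nat \<Rightarrow> 'w \<Rightarrow> 's) \<Rightarrow> bool" where
  "markov_chain M S K Z \<longleftrightarrow>
     prob_space M \<and> (\<forall>n. Z n \<in> measurable M S) \<and>
     (\<forall>n. \<forall>A\<in>sets S. AE \<omega> in M.
        nn_cond_exp M (history M S Z n) (indicator (Z (Suc n) -` A \<inter> space M)) \<omega>
          = emeasure (K (Z n \<omega>)) A)"

text \<open>\<open>q u v\<close> is a conditional density, with respect to \<open>\<mu>\<close>, of \<open>U\<close> given \<open>V = v\<close>.\<close>

definition conditional_density ::
  "'w measure \<Rightarrow> 'u measure \<Rightarrow> 'v measure \<Rightarrow> ('w \<Rightarrow> 'u) \<Rightarrow> ('w \<Rightarrow> 'v)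
     \<Rightarrow> ('u \<Rightarrow> 'v \<Rightarrow> ennreal) \<Rightarrow> bool" where
  "conditional_density M \<mu> S U V q \<longleftrightarrow>
     (\<lambda>(u, v). q u v) \<in> borel_measurable (\<mu> \<Otimes>\<^sub>M S) \<and>
     (\<forall>A\<in>sets \<mu>. AE \<omega> in M.
        nn_cond_exp M (vimage_algebra (space M) V S) (indicator (U -` A \<inter> space M)) \<omega>
          = (\<integral>\<^sup>+u\<in>A. q u (V \<omega>) \<partial>\<mu>))"

section \<open>Group actions and Haar measure\<close>

text \<open>Topological groups are taken from the class \<^class>\<open>topological_group_add\<close>, which does
  not assume commutativity: \<open>g + h\<close>, \<open>0\<close> and \<open>- g\<close> are the product, the identity and the
  inverse. Separability is rendered by \<^class>\<open>second_countable_topology\<close>.\<close>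

definition topological_left_action ::
  "('g::topological_group_add \<Rightarrow> 'y::topological_space \<Rightarrow> 'y) \<Rightarrow> bool" where
  "topological_left_action act \<longleftrightarrow>
     continuous_on UNIV (\<lambda>(g, y). act g y) \<and>
     (\<forall>y. act 0 y = y) \<and>
     (\<forall>g h y. act (g + h) y = act g (act h y))"

text \<open>An identity between integrals includes the existence of both sides, hence
  \<^const>\<open>has_bochner_integral\<close>.\<close>

definition action_jacobian ::
  "'y::topological_space measure \<Rightarrow> ('g::topological_group_add \<Rightarrow> 'y \<Rightarrow> 'y)
     \<Rightarrow> ('g \<Rightarrow> 'y \<Rightarrow> real) \<Rightarrow> bool" where
  "action_jacobian \<mu> act j \<longleftrightarrow>
     (\<lambda>(g, y). j g y) \<in> borel_measurable (borel \<Otimes>\<^sub>M borel) \<and>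
     (\<forall>g y. 0 < j g y) \<and>
     (\<forall>g y. j (- g) y = 1 / j g y) \<and>
     (\<forall>g h y. j (g + h) y = j g (act h y) * j h y) \<and>
     (\<forall>g (h :: 'y \<Rightarrow> real). integrable \<mu> h \<longrightarrow>
        has_bochner_integral \<mu> (\<lambda>y. h (act g y) * j g y) (\<integral>y. h y \<partial>\<mu>))"

text \<open>As usual for Haar measures, finiteness on compact sets is part of the notion.\<close>

definition left_haar_measure :: "'g::topological_group_add measure \<Rightarrow> bool" where
  "left_haar_measure \<nu> \<longleftrightarrow>
     sets \<nu> = sets borel \<and> emeasure \<nu> UNIV \<noteq> 0 \<and>
     (\<forall>C. compact C \<longrightarrow> emeasure \<nu> C < \<infinity>) \<and>
     (\<forall>a (h :: 'g \<Rightarrow> real). integrable \<nu> h \<longrightarrow>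
        has_bochner_integral \<nu> (\<lambda>g. h (a + g)) (\<integral>g. h g \<partial>\<nu>))"

section \<open>The densities of the PX-DA construction\<close>

definition marginal_x :: "'y measure \<Rightarrow> ('x \<Rightarrow> 'y \<Rightarrow> real) \<Rightarrow> 'x \<Rightarrow> ennreal" where
  "marginal_x \<mu>y f x = (\<integral>\<^sup>+y. ennreal (f x y) \<partial>\<mu>y)"

definition marginal_y :: "'x measure \<Rightarrow> ('x \<Rightarrow> 'y \<Rightarrow> real) \<Rightarrow> 'y \<Rightarrow> ennreal" where
  "marginal_y \<mu>x f y = (\<integral>\<^sup>+x. ennreal (f x y) \<partial>\<mu>x)"

text \<open>\<open>\<phi>x\<close> and \<open>\<phi>y\<close> are the fixed probability densities that are used where the
  denominator is not in \<open>(0,\<infinity>)\<close>.\<close>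

definition cond_x_given_y ::
  "'x measure \<Rightarrow> ('x \<Rightarrow> 'y \<Rightarrow> real) \<Rightarrow> ('x \<Rightarrow> real) \<Rightarrow> 'x \<Rightarrow> 'y \<Rightarrow> ennreal" where
  "cond_x_given_y \<mu>x f \<phi>x x y =
     (if 0 < marginal_y \<mu>x f y \<and> marginal_y \<mu>x f y < \<infinity>
      then ennreal (f x y) / marginal_y \<mu>x f y else ennreal (\<phi>x x))"

definition cond_y_given_x ::
  "'y measure \<Rightarrow> ('x \<Rightarrow> 'y \<Rightarrow> real) \<Rightarrow> ('y \<Rightarrow> real) \<Rightarrow> 'y \<Rightarrow> 'x \<Rightarrow> ennreal" where
  "cond_y_given_x \<mu>y f \<phi>y y x =
     (if 0 < marginal_x \<mu>y f x \<and> marginal_x \<mu>y f x < \<infinity>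
      then ennreal (f x y) / marginal_x \<mu>y f x else ennreal (\<phi>y y))"

definition orbit_mass ::
  "'x measure \<Rightarrow> ('x \<Rightarrow> 'y \<Rightarrow> real) \<Rightarrow> ('g \<Rightarrow> 'y \<Rightarrow> 'y) \<Rightarrow> ('g \<Rightarrow> 'y \<Rightarrow> real)
     \<Rightarrow> 'g measure \<Rightarrow> 'y \<Rightarrow> ennreal" where
  "orbit_mass \<mu>x f act j \<nu> y = (\<integral>\<^sup>+g. marginal_y \<mu>x f (act g y) * ennreal (j g y) \<partial>\<nu>)"

definition Ybar ::
  "'x measure \<Rightarrow> ('x \<Rightarrow> 'y \<Rightarrow> real) \<Rightarrow> ('g \<Rightarrow> 'y \<Rightarrow> 'y) \<Rightarrow> ('g \<Rightarrow> 'y \<Rightarrow> real)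
     \<Rightarrow> 'g measure \<Rightarrow> 'y set" where
  "Ybar \<mu>x f act j \<nu> = {y. orbit_mass \<mu>x f act j \<nu> y < \<infinity>}"

definition fhat ::
  "('x \<Rightarrow> 'y \<Rightarrow> real) \<Rightarrow> ('g \<Rightarrow> 'y \<Rightarrow> 'y) \<Rightarrow> ('g \<Rightarrow> 'y \<Rightarrow> real)
     \<Rightarrow> 'x \<Rightarrow> 'y \<Rightarrow> 'g \<Rightarrow> real" where
  "fhat f act j x y g = f x (act g y) * j g y"

text \<open>Where the denominator is not in \<open>(0,\<infinity>)\<close>, the density of \<open>y\<close> is the one for which
  \<open>act g y\<close> has density \<open>\<phi>y\<close>, in line with the convention in \<^const>\<open>cond_y_given_x\<close>.\<close>

definition fhat_y_given_xg ::
  "'y measure \<Rightarrow> ('x \<Rightarrow> 'y \<Rightarrow> real) \<Rightarrow> ('g \<Rightarrow> 'y \<Rightarrow> 'y) \<Rightarrow> ('g \<Rightarrow> 'y \<Rightarrow> real)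
     \<Rightarrow> ('y \<Rightarrow> real) \<Rightarrow> 'y \<Rightarrow> 'x \<times> 'g \<Rightarrow> ennreal" where
  "fhat_y_given_xg \<mu>y f act j \<phi>y y = (\<lambda>(x, g).
     let D = (\<integral>\<^sup>+v. ennreal (fhat f act j x v g) \<partial>\<mu>y) in
     if 0 < D \<and> D < \<infinity> then ennreal (fhat f act j x y g) / D
     else ennreal (\<phi>y (act g y) * j g y))"

definition fhat_xg_given_y ::
  "'x measure \<Rightarrow> ('x \<Rightarrow> 'y \<Rightarrow> real) \<Rightarrow> ('g \<Rightarrow> 'y \<Rightarrow> 'y) \<Rightarrow> ('g \<Rightarrow> 'y \<Rightarrow> real)
     \<Rightarrow> 'g measure \<Rightarrow> 'x \<times> 'g \<Rightarrow> 'y \<Rightarrow> ennreal" where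
  "fhat_xg_given_y \<mu>x f act j \<nu> = (\<lambda>(x, g) y.
     ennreal (fhat f act j x y g) /
       (\<integral>\<^sup>+h. (\<integral>\<^sup>+u. ennreal (fhat f act j u y h) \<partial>\<mu>x) \<partial>\<nu>))"

definition pstar_xg ::
  "'x measure \<Rightarrow> 'y measure \<Rightarrow> ('x \<Rightarrow> 'y \<Rightarrow> real) \<Rightarrow> ('y \<Rightarrow> real) \<Rightarrow> ('g \<Rightarrow> 'y \<Rightarrow> 'y)
     \<Rightarrow> ('g \<Rightarrow> 'y \<Rightarrow> real) \<Rightarrow> 'g measure \<Rightarrow> 'x \<times> 'g \<Rightarrow> 'x \<times> 'g \<Rightarrow> ennreal" where
  "pstar_xg \<mu>x \<mu>y f \<phi>y act j \<nu> z z' =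
     (\<integral>\<^sup>+y\<in>Ybar \<mu>x f act j \<nu>.
        fhat_xg_given_y \<mu>x f act j \<nu> z y * fhat_y_given_xg \<mu>y f act j \<phi>y y z' \<partial>\<mu>y)"

definition Q_kernel ::
  "'x measure \<Rightarrow> 'y::topological_space measure \<Rightarrow> ('x \<Rightarrow> 'y \<Rightarrow> real) \<Rightarrow> ('g \<Rightarrow> 'y \<Rightarrow> 'y)
     \<Rightarrow> ('g \<Rightarrow> 'y \<Rightarrow> real) \<Rightarrow> 'g measure \<Rightarrow> 'y \<Rightarrow> 'y measure" where
  "Q_kernel \<mu>x \<mu>y f act j \<nu> y =
     (if y \<in> Ybar \<mu>x f act j \<nu>
      then distr
             (density \<nu> (\<lambda>g. marginal_y \<mu>x f (act g y) * ennreal (j g y)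
                              / orbit_mass \<mu>x f act j \<nu> y))
             borel (\<lambda>g. act g y)
      else density \<mu>y (marginal_y \<mu>x f))"

definition pstar_x ::
  "'x measure \<Rightarrow> 'y::topological_space measure \<Rightarrow> ('x \<Rightarrow> 'y \<Rightarrow> real) \<Rightarrow> ('x \<Rightarrow> real)
     \<Rightarrow> ('y \<Rightarrow> real) \<Rightarrow> ('g \<Rightarrow> 'y \<Rightarrow> 'y) \<Rightarrow> ('g \<Rightarrow> 'y \<Rightarrow> real) \<Rightarrow> 'g measure
     \<Rightarrow> 'x \<Rightarrow> 'x \<Rightarrow> ennreal" where
  "pstar_x \<mu>x \<mu>y f \<phi>x \<phi>y act j \<nu> x x' =
     (\<integral>\<^sup>+y. (\<integral>\<^sup>+y'. cond_x_given_y \<mu>x f \<phi>x x y' \<partial>Q_kernel \<mu>x \<mu>y f act j \<nu> y)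
            * cond_y_given_x \<mu>y f \<phi>y y x' \<partial>\<mu>y)"

end

theory Submission
  imports Defs
begin

text \<open>Since \<open>\<nu>\<close> is unique up to a factor, the integrals \<open>\<integral>h(gy)j(g,y)\<nu>(dg)\<close> for different \<open>h\<close> all
  change by one and the same factor when \<open>y\<close> moves along its orbit. Therefore
  \<open>\<integral>f(x,gy)j(g,y)\<nu>(dg)/m(y)\<close> is constant on orbits, and the change of variables \<open>y \<mapsto> g'y\<close>
  removes \<open>g'\<close> from \<open>\<integral>p\<^sup>*((x,g)|(x',g'))\<nu>(dg)\<close>. The invariance in (a) is Tonelli's theorem
  together with \<open>f\<^bsub>Y|X\<^esub>(y|x) f\<^bsub>X\<^esub>(x) = f(x,y)\<close>. Positive recurrence is refuted by a general
  fact: an irreducible chain with a transition density cannot have both an invariant density of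
  infinite mass and an invariant probability measure.\<close>

section \<open>Invariant measures on groups\<close>

text \<open>The hypotheses on \<open>j\<close> and \<open>\<nu>\<close> speak of integrable real
  functions, while the derived densities may be infinite on null sets; all arguments are therefore
  carried out with integrals in [0,\<infinity>], where Tonelli applies without integrability
  conditions. The group need not be unimodular. Moving y to ay right-translates a left invariant
  measure, so an orbit integral is multiplied by a modular factor divided by j(a,y); what matters is
  only that this number lies in (0,\<infinity>) and is the same for every h. The equality in (b) is
  asserted for almost every x because f_Y(gy) f_{X|Y}(x|gy) = f(x,gy) may fail on an x-null set that
  depends on gy. Fubini for null sets merges these into one null set, and integration over x erases
  it, so the kernels themselves agree at every (x',g'). In (a), infinite mass of one invariant
  measure does not by itself exclude an invariant probability measure: a reducible chain can have
  both. Irreducibility has to be used, and it is defined by an arbitrary reference measure that need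
  not be related to \<open>\<mu>x \<Otimes>\<^sub>M \<nu>\<close>. The comparison of densities
  avoids relating the two.\<close>

lemma nn_integral_eq_if_has_bochner_integral_eq:
  assumes sf: "sigma_finite_measure M"
    and T[measurable]: "T \<in> measurable M M" and w[measurable]: "w \<in> borel_measurable M"
    and w0: "\<And>y. 0 \<le> w y"
    and inv: "\<And>h::'a \<Rightarrow> real. integrable M h \<Longrightarrow>
      has_bochner_integral M (\<lambda>y. h (T y) * w y) (\<integral>y. h y \<partial>M)"
    and h[measurable]: "h \<in> borel_measurable M"
  shows "(\<integral>\<^sup>+y. h (T y) * ennreal (w y) \<partial>M) = (\<integral>\<^sup>+y. h y \<partial>M)"
proof -
  interpret sigma_finite_measure M by fact
  define N where "N = distr (density M (\<lambda>y. ennreal (w y))) M T"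
  have setsN[measurable_cong, simp]: "sets N = sets M"
    by (simp add: N_def)
  \<comment> \<open>The invariance hypothesis applies to indicators of sets of finite measure only;
    an exhaustion of the space by such sets then gives \<open>N = M\<close>, and with it the formula
    for all nonnegative functions.\<close>
  have fin: "emeasure N A = emeasure M A" if A[measurable]: "A \<in> sets M" and "emeasure M A < \<infinity>" for A
  proof -
    have "has_bochner_integral M (\<lambda>y. indicator A (T y) * w y) (measure M A)"
      using inv[of "indicator A"] that by simp
    then have "(\<integral>\<^sup>+y. ennreal (indicator A (T y) * w y) \<partial>M) = ennreal (measure M A)"
      by (subst nn_integral_eq_integral) (auto simp: w0 has_bochner_integral_iff)
    moreover have "emeasure N A = (\<integral>\<^sup>+y. ennreal (indicator A (T y) * w y) \<partial>M)"
      using A unfolding N_def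
      by (subst emeasure_distr)
         (auto simp: emeasure_density intro!: nn_integral_cong split: split_indicator)
    ultimately show ?thesis
      using that by (simp add: emeasure_eq_ennreal_measure)
  qed
  obtain F :: "nat \<Rightarrow> 'a set" where F: "range F \<subseteq> sets M" "(\<Union>i. F i) = space M"
    "\<And>i. emeasure M (F i) \<noteq> \<infinity>" "incseq F"
    using sigma_finite_incseq by metis
  have "N = M"
  proof (rule measure_eqI)
    fix A assume "A \<in> sets N"
    then have A[measurable]: "A \<in> sets M" by simp
    have [measurable]: "F i \<in> sets M" for i using F by auto
    have U: "(\<Union>i. A \<inter> F i) = A"
      using F(2) sets.sets_into_space[OF A] by auto
    have inc: "incseq (\<lambda>i. A \<inter> F i)"
      using F(4) by (auto simp: incseq_def)
    have "emeasure M (A \<inter> F i) < \<infinity>" for i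
      using emeasure_mono[of "A \<inter> F i" "F i" M] F(3)[of i] by (auto simp: less_top[symmetric] top_unique)
    then have "emeasure N (A \<inter> F i) = emeasure M (A \<inter> F i)" for i
      by (intro fin) auto
    then show "emeasure N A = emeasure M A"
      using SUP_emeasure_incseq[of "\<lambda>i. A \<inter> F i" N] SUP_emeasure_incseq[of "\<lambda>i. A \<inter> F i" M] inc U
      by (simp add: image_subset_iff)
  qed simp
  then have "(\<integral>\<^sup>+y. h y \<partial>M) = (\<integral>\<^sup>+y. h y \<partial>N)" by simp
  also have "\<dots> = (\<integral>\<^sup>+y. h (T y) * ennreal (w y) \<partial>M)"
    unfolding N_def by (simp add: nn_integral_distr nn_integral_density mult.commute)
  finally show ?thesis by simp
qed

text \<open>Tonelli needs sigma-finiteness, whereas a Haar measure is only known to be finite on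
  compact sets. Local compactness covers the space by open sets that lie in compact ones, and
  Lindelof extracts a countable subcover.\<close>

lemma sigma_finite_if_finite_on_compacts:
  fixes M :: "'a::{metric_space, second_countable_topology} measure"
  assumes lc: "locally compact (UNIV :: 'a set)" and s: "sets M = sets borel"
    and fin: "\<And>C. compact C \<Longrightarrow> emeasure M C < \<infinity>"
  shows "sigma_finite_measure M"
proof -
  define \<F> where "\<F> = {U :: 'a set. open U \<and> (\<exists>C. compact C \<and> U \<subseteq> C)}"
  obtain \<F>' where F': "\<F>' \<subseteq> \<F>" "countable \<F>'" "\<Union>\<F>' = \<Union>\<F>"
    using Lindelof[of \<F>] by (auto simp: \<F>_def)
  have sp: "space M = UNIV" using sets_eq_imp_space_eq[OF s] by simp
  have "\<exists>U\<in>\<F>. x \<in> U" for x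
    using lc unfolding locally_def \<F>_def by (auto dest!: spec[of _ UNIV] spec[of _ x])
  then have U: "\<Union>\<F>' = UNIV" using F' by auto
  show ?thesis
  proof (standard, intro exI[of _ \<F>'] conjI ballI)
    show "\<F>' \<subseteq> sets M" using F' by (auto simp: s \<F>_def)
    fix V assume "V \<in> \<F>'"
    then obtain C where C: "compact C" "V \<subseteq> C" using F' by (auto simp: \<F>_def)
    have "emeasure M V \<le> emeasure M C"
      using C by (intro emeasure_mono) (auto simp: s borel_compact)
    then show "emeasure M V \<noteq> \<infinity>" using fin[OF C(1)] by auto
  qed (use F' U sp in auto)
qed

section \<open>Uniqueness of left invariant measures up to a factor\<close>

lemma borel_measurable_group_uminus[measurable (raw)]:
  fixes g :: "'a \<Rightarrow> 'g::{second_countable_topology, topological_group_add}"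
  assumes "g \<in> borel_measurable M"
  shows "(\<lambda>x. - g x) \<in> borel_measurable M"
  by (rule borel_measurable_continuous_on[OF _ assms]) (intro continuous_on_minus continuous_on_id)

text \<open>The map \<open>(x, y) \<mapsto> (- y, x + y)\<close> is a composition of two shears and therefore preserves
  the product of two left invariant measures.\<close>

lemma nn_integral_left_invariant_twist:
  fixes M N :: "'g::{second_countable_topology, topological_group_add} measure"
  assumes sM: "sigma_finite_measure M" and sN: "sigma_finite_measure N"
    and [measurable_cong]: "sets M = sets borel" "sets N = sets borel"
    and iM: "\<And>a h. h \<in> borel_measurable borel \<Longrightarrow> (\<integral>\<^sup>+x. h (a + x) \<partial>M) = (\<integral>\<^sup>+x. h x \<partial>M)"
    and iN: "\<And>a h. h \<in> borel_measurable borel \<Longrightarrow> (\<integral>\<^sup>+x. h (a + x) \<partial>N) = (\<integral>\<^sup>+x. h x \<partial>N)"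
    and [measurable]: "a \<in> borel_measurable borel" "b \<in> borel_measurable borel"
  shows "(\<integral>\<^sup>+y. a (- y) * (\<integral>\<^sup>+x. b (x + y) \<partial>M) \<partial>N) = (\<integral>\<^sup>+x. a x \<partial>M) * (\<integral>\<^sup>+y. b y \<partial>N)"
proof -
  interpret M: sigma_finite_measure M by fact
  interpret N: sigma_finite_measure N by fact
  interpret P: pair_sigma_finite M N ..
  have "(\<integral>\<^sup>+y. a (- y) * (\<integral>\<^sup>+x. b (x + y) \<partial>M) \<partial>N) = (\<integral>\<^sup>+y. (\<integral>\<^sup>+x. a (- y) * b (x + y) \<partial>M) \<partial>N)"
    by (simp add: nn_integral_cmult)
  also have "\<dots> = (\<integral>\<^sup>+x. (\<integral>\<^sup>+y. a (- y) * b (x + y) \<partial>N) \<partial>M)"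
    by (intro P.Fubini') measurable
  \<comment> \<open>Since \<open>- y = - (x + y) + x\<close>, the integrand is a function of
    \<open>x + y\<close>, so left invariance of \<open>N\<close> removes the shift. The remaining
    \<open>- y + x\<close> is a left translate of \<open>x\<close>, which invariance of
    \<open>M\<close> removes next; the order of the summands matters.\<close>
  also have "\<dots> = (\<integral>\<^sup>+x. (\<integral>\<^sup>+y. a (- y + x) * b y \<partial>N) \<partial>M)"
  proof (rule nn_integral_cong)
    fix x
    have "(\<integral>\<^sup>+y. a (- y) * b (x + y) \<partial>N) = (\<integral>\<^sup>+y. a (- (x + y) + x) * b (x + y) \<partial>N)"
      by (simp add: minus_add add.assoc)
    also have "\<dots> = (\<integral>\<^sup>+y. a (- y + x) * b y \<partial>N)"
      by (rule iN[where h="\<lambda>y. a (- y + x) * b y"]) measurable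
    finally show "(\<integral>\<^sup>+y. a (- y) * b (x + y) \<partial>N) = (\<integral>\<^sup>+y. a (- y + x) * b y \<partial>N)" .
  qed
  also have "\<dots> = (\<integral>\<^sup>+y. (\<integral>\<^sup>+x. a (- y + x) * b y \<partial>M) \<partial>N)"
    by (intro P.Fubini'[symmetric]) measurable
  also have "\<dots> = (\<integral>\<^sup>+y. (\<integral>\<^sup>+x. a x \<partial>M) * b y \<partial>N)"
    by (simp add: nn_integral_multc iM)
  also have "\<dots> = (\<integral>\<^sup>+x. a x \<partial>M) * (\<integral>\<^sup>+y. b y \<partial>N)"
    by (simp add: nn_integral_cmult)
  finally show ?thesis .
qed

text \<open>Fix a positive \<open>b\<close> and let \<open>D y\<close> be the integral of
  \<open>b (x + y)\<close> over \<open>M\<close>. The twist identity with a suitable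
  \<open>a\<close> expresses the integral of any \<open>c\<close> over \<open>L\<close> as a number
  independent of \<open>L\<close> times the integral of \<open>b\<close> over \<open>L\<close>.
  Taking \<open>L\<close> to be \<open>M\<close> and \<open>N\<close> and dividing gives the
  constant.\<close>

lemma left_invariant_measure_unique:
  fixes M N :: "'g::{second_countable_topology, topological_group_add} measure"
  assumes sM: "sigma_finite_measure M" and sN: "sigma_finite_measure N"
    and sets[measurable_cong]: "sets M = sets borel" "sets N = sets borel"
    and iM: "\<And>a h. h \<in> borel_measurable borel \<Longrightarrow> (\<integral>\<^sup>+x. h (a + x) \<partial>M) = (\<integral>\<^sup>+x. h x \<partial>M)"
    and iN: "\<And>a h. h \<in> borel_measurable borel \<Longrightarrow> (\<integral>\<^sup>+x. h (a + x) \<partial>N) = (\<integral>\<^sup>+x. h x \<partial>N)"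
    and M0: "emeasure M UNIV \<noteq> 0" and N0: "emeasure N UNIV \<noteq> 0"
  obtains k where "0 < k" "k < \<infinity>"
    "\<And>c. c \<in> borel_measurable borel \<Longrightarrow> (\<integral>\<^sup>+x. c x \<partial>N) = k * (\<integral>\<^sup>+x. c x \<partial>M)"
proof -
  interpret M: sigma_finite_measure M by fact
  interpret N: sigma_finite_measure N by fact
  have sp: "space M = UNIV" "space N = UNIV"
    using sets_eq_imp_space_eq[OF sets(1)] sets_eq_imp_space_eq[OF sets(2)] by auto
  obtain b1 where b1[measurable]: "b1 \<in> borel_measurable borel"
    and b1': "integral\<^sup>N M b1 \<noteq> \<infinity>" "\<And>x. 0 < b1 x" "\<And>x. b1 x < \<infinity>"
    using M.Ex_finite_integrable_function sp by (auto simp: measurable_cong_sets[OF sets(1) refl])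
  obtain b2 where b2[measurable]: "b2 \<in> borel_measurable borel"
    and b2': "integral\<^sup>N N b2 \<noteq> \<infinity>" "\<And>x. 0 < b2 x" "\<And>x. b2 x < \<infinity>"
    using N.Ex_finite_integrable_function sp by (auto simp: measurable_cong_sets[OF sets(2) refl])
  \<comment> \<open>One test function serves both measures: the minimum is still strictly positive
    and has a finite integral with respect to each.\<close>
  define b where "b x = min (b1 x) (b2 x)" for x
  have [measurable]: "b \<in> borel_measurable borel"
    unfolding b_def by measurable
  have b0: "0 < b x" for x using b1' b2' by (simp add: b_def)
  have bM: "integral\<^sup>N M b < \<infinity>"
    using nn_integral_mono[of M b b1] b1'(1) by (auto simp: b_def less_top[symmetric] top_unique)
  have bN: "integral\<^sup>N N b < \<infinity>"
    using nn_integral_mono[of N b b2] b2'(1) by (auto simp: b_def less_top[symmetric] top_unique)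
  have pos: "0 < (\<integral>\<^sup>+x. h x \<partial>L)" if "sets L = sets borel" "emeasure L UNIV \<noteq> 0"
    "h \<in> borel_measurable borel" "\<And>x. 0 < h x" for h :: "'g \<Rightarrow> ennreal" and L
  proof (rule ccontr)
    have m: "h \<in> borel_measurable L" using that(1,3) by (simp add: measurable_cong_sets[OF that(1) refl])
    have spL: "space L = UNIV" using sets_eq_imp_space_eq[OF that(1)] by simp
    assume "\<not> ?thesis"
    then have "AE x in L. h x = 0" using nn_integral_0_iff_AE[OF m] by simp
    then have "AE x in L. False" by eventually_elim (metis that(4) less_irrefl)
    then have "emeasure L UNIV = 0"
      using AE_iff_measurable[of UNIV L "\<lambda>_. False"] that(1) spL by simp
    then show False using that(2) by simp
  qed
  have bM0: "0 < integral\<^sup>N M b" and bN0: "0 < integral\<^sup>N N b"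
    using pos[of M b] pos[of N b] sets M0 N0 b0 by auto
  define D where "D y = (\<integral>\<^sup>+x. b (x + y) \<partial>M)" for y
  have [measurable]: "D \<in> borel_measurable borel"
    unfolding D_def by measurable
  have D0: "0 < D y" for y
    unfolding D_def by (intro pos sets M0 b0) measurable
  have twist: "(\<integral>\<^sup>+y. a (- y) * D y \<partial>L) = integral\<^sup>N M a * integral\<^sup>N L b"
    if "sigma_finite_measure L" "sets L = sets borel"
    and "\<And>a h. h \<in> borel_measurable borel \<Longrightarrow> (\<integral>\<^sup>+x. h (a + x) \<partial>L) = (\<integral>\<^sup>+x. h x \<partial>L)"
    and "a \<in> borel_measurable borel" for L a
    unfolding D_def
    by (rule nn_integral_left_invariant_twist) (fact that sM sets iM \<open>b \<in> borel_measurable borel\<close>)+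
  \<comment> \<open>The twist with \<open>a = b\<close> bounds the integral of
    \<open>b (- y) * D y\<close>, and \<open>b (- y) > 0\<close> passes the finiteness on to
    \<open>D y\<close>.\<close>
  have fin: "AE y in L. D y < \<infinity>" if "sigma_finite_measure L"
    and [measurable_cong]: "sets L = sets borel" and bL: "integral\<^sup>N L b < \<infinity>"
    and "\<And>a h. h \<in> borel_measurable borel \<Longrightarrow> (\<integral>\<^sup>+x. h (a + x) \<partial>L) = (\<integral>\<^sup>+x. h x \<partial>L)" for L
  proof -
    have "(\<integral>\<^sup>+y. b (- y) * D y \<partial>L) = integral\<^sup>N M b * integral\<^sup>N L b"
      by (rule twist) (fact that \<open>b \<in> borel_measurable borel\<close>)+
    also have "\<dots> < \<infinity>" using bM bL by (simp add: ennreal_mult_less_top)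
    finally have "AE y in L. b (- y) * D y \<noteq> \<infinity>"
      by (intro nn_integral_PInf_AE) auto
    then show ?thesis
    proof eventually_elim
      case (elim y) then show ?case using b0[of "- y"] by (auto simp: ennreal_mult_eq_top_iff less_top)
    qed
  qed
  \<comment> \<open>The choice \<open>a x = c (- x) / D (- x)\<close> makes
    \<open>a (- y) * D y = c y\<close>, as \<open>D\<close> is positive everywhere and finite almost
    everywhere.\<close>
  have key: "(\<integral>\<^sup>+x. c x \<partial>L) = (\<integral>\<^sup>+x. c (- x) / D (- x) \<partial>M) * integral\<^sup>N L b"
    if "sigma_finite_measure L"
    and [measurable_cong]: "sets L = sets borel" and bL: "integral\<^sup>N L b < \<infinity>"
    and "\<And>a h. h \<in> borel_measurable borel \<Longrightarrow> (\<integral>\<^sup>+x. h (a + x) \<partial>L) = (\<integral>\<^sup>+x. h x \<partial>L)"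
    and [measurable]: "c \<in> borel_measurable borel" for L c
  proof -
    have m: "(\<lambda>x. c (- x) / D (- x)) \<in> borel_measurable borel"
      by measurable
    have "AE y in L. D y < \<infinity>"
      by (rule fin) (fact that)+
    then have "(\<integral>\<^sup>+x. c x \<partial>L) = (\<integral>\<^sup>+y. c (- (- y)) / D (- (- y)) * D y \<partial>L)"
    proof (intro nn_integral_cong_AE, eventually_elim)
      case (elim y)
      have "c y / D y * D y = c y * D y / D y" by (simp add: divide_ennreal_def ac_simps)
      with elim D0[of y] show ?case by (simp add: ennreal_mult_divide_eq)
    qed
    also have "\<dots> = (\<integral>\<^sup>+x. c (- x) / D (- x) \<partial>M) * integral\<^sup>N L b"
      by (rule twist) (fact that m)+
    finally show ?thesis .
  qed
  show thesis
  proof (rule that[of "integral\<^sup>N N b / integral\<^sup>N M b"])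
    show "0 < integral\<^sup>N N b / integral\<^sup>N M b"
      using bN0 bM by (simp add: ennreal_zero_less_divide)
    show "integral\<^sup>N N b / integral\<^sup>N M b < \<infinity>"
      using bM0 bN by (auto simp: less_top[symmetric] ennreal_divide_eq_top_iff)
    fix c :: "'g \<Rightarrow> ennreal" assume c: "c \<in> borel_measurable borel"
    let ?C = "\<integral>\<^sup>+x. c (- x) / D (- x) \<partial>M"
    have "integral\<^sup>N N b / integral\<^sup>N M b * (\<integral>\<^sup>+x. c x \<partial>M) = (?C * integral\<^sup>N N b) * integral\<^sup>N M b / integral\<^sup>N M b"
      using key[OF sM sets(1) bM iM c] by (simp add: divide_ennreal_def ac_simps)
    also have "\<dots> = ?C * integral\<^sup>N N b"
      using bM bM0 by (intro ennreal_mult_divide_eq) auto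
    finally show "(\<integral>\<^sup>+x. c x \<partial>N) = integral\<^sup>N N b / integral\<^sup>N M b * (\<integral>\<^sup>+x. c x \<partial>M)"
      using key[OF sN sets(2) bN iN c] by simp
  qed
qed

text \<open>Left and right translations commute, so a right translate of \<open>M\<close> is again
  left invariant and hence a multiple of \<open>M\<close>. Up to convention, \<open>k\<close> is the
  value of the modular function at \<open>a\<close>.\<close>

lemma left_invariant_right_translation:
  fixes M :: "'g::{second_countable_topology, topological_group_add} measure"
  assumes sM: "sigma_finite_measure M" and sets[measurable_cong]: "sets M = sets borel"
    and iM: "\<And>a h. h \<in> borel_measurable borel \<Longrightarrow> (\<integral>\<^sup>+x. h (a + x) \<partial>M) = (\<integral>\<^sup>+x. h x \<partial>M)"
    and M0: "emeasure M UNIV \<noteq> 0"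
  obtains k where "0 < k" "k < \<infinity>"
    "\<And>h. h \<in> borel_measurable borel \<Longrightarrow> (\<integral>\<^sup>+x. h (x + a) \<partial>M) = k * (\<integral>\<^sup>+x. h x \<partial>M)"
proof -
  define N where "N = distr M borel (\<lambda>x. x + a)"
  have sets_N: "sets N = sets borel" by (simp add: N_def)
  have I: "(\<integral>\<^sup>+x. h x \<partial>N) = (\<integral>\<^sup>+x. h (x + a) \<partial>M)" if [measurable]: "h \<in> borel_measurable borel" for h
    unfolding N_def by (intro nn_integral_distr) measurable
  have meas: "(\<lambda>x. x + - a) \<in> measurable N M" "(\<lambda>x. x + a) \<in> measurable M borel"
    by (simp_all only: measurable_cong_sets[OF sets_N sets] measurable_cong_sets[OF sets refl]) measurable
  \<comment> \<open>Translating back recovers \<open>M\<close>, so sigma-finiteness of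
    \<open>M\<close> is inherited by \<open>N\<close>.\<close>
  have "distr N M (\<lambda>x. x + - a) = distr M M (\<lambda>x. x)"
    unfolding N_def by (subst distr_distr)
      (simp_all add: o_def add.assoc meas[unfolded N_def] del: add_uminus_conv_diff)
  also have "\<dots> = M" by (rule distr_id2) simp
  finally have sN: "sigma_finite_measure N"
    using sM by (intro sigma_finite_measure_distr[of N M "\<lambda>x. x + - a"]) (simp_all only: meas)
  have N0: "emeasure N UNIV \<noteq> 0"
    using M0 sets_eq_imp_space_eq[OF sets] by (simp add: N_def emeasure_distr)
  have iN: "(\<integral>\<^sup>+x. h (c + x) \<partial>N) = (\<integral>\<^sup>+x. h x \<partial>N)" if [measurable]: "h \<in> borel_measurable borel" for c h
    using iM[of "\<lambda>x. h (x + a)" c] by (simp add: I add.assoc)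
  show thesis
    using left_invariant_measure_unique[OF sM sN sets sets_N iM iN M0 N0] that I by metis
qed

section \<open>Chains with a transition density\<close>

locale density_chain = sigma_finite_measure M for M :: "'s measure" +
  fixes p :: "'s \<Rightarrow> 's \<Rightarrow> ennreal"
  assumes transition_density: "transition_density M p"
begin

lemma p_measurable[measurable (raw)]:
  assumes "f \<in> measurable N M" "g \<in> measurable N M"
  shows "(\<lambda>x. p (f x) (g x)) \<in> borel_measurable N"
proof -
  have "(\<lambda>(z, z'). p z z') \<in> borel_measurable (M \<Otimes>\<^sub>M M)"
    using transition_density by (simp add: transition_density_def)
  from measurable_compose[OF measurable_Pair[OF assms] this] show ?thesis by simp
qed

lemma nn_integral_p: "z' \<in> space M \<Longrightarrow> (\<integral>\<^sup>+z. p z z' \<partial>M) = 1"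
  using transition_density by (simp add: transition_density_def)

text \<open>The action of the chain on densities: if the present state has density \<open>h\<close>,
  the next one has density \<open>push h\<close>. Invariant densities are its fixed points almost
  everywhere.\<close>

definition push :: "('s \<Rightarrow> ennreal) \<Rightarrow> 's \<Rightarrow> ennreal" where
  "push h w = (\<integral>\<^sup>+z. p w z * h z \<partial>M)"

lemma push_measurable[measurable]:
  assumes [measurable]: "h \<in> borel_measurable M"
  shows "push h \<in> borel_measurable M"
  unfolding push_def[abs_def] by measurable

text \<open>By Tonelli, \<open>push\<close> is adjoint to the operator that sends \<open>u\<close>
  to its expectation after one step.\<close>

lemma nn_integral_push:
  assumes [measurable]: "u \<in> borel_measurable M" "h \<in> borel_measurable M"
  shows "(\<integral>\<^sup>+w. u w * push h w \<partial>M) = (\<integral>\<^sup>+z. (\<integral>\<^sup>+w. p w z * u w \<partial>M) * h z \<partial>M)"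
proof -
  interpret P: pair_sigma_finite M M ..
  have "(\<integral>\<^sup>+w. u w * push h w \<partial>M) = (\<integral>\<^sup>+w. (\<integral>\<^sup>+z. u w * (p w z * h z) \<partial>M) \<partial>M)"
    unfolding push_def by (intro nn_integral_cong nn_integral_cmult[symmetric]) measurable
  also have "\<dots> = (\<integral>\<^sup>+z. (\<integral>\<^sup>+w. u w * (p w z * h z) \<partial>M) \<partial>M)"
    by (rule P.Fubini'[symmetric]) measurable
  also have "\<dots> = (\<integral>\<^sup>+z. (\<integral>\<^sup>+w. p w z * u w \<partial>M) * h z \<partial>M)"
    by (intro nn_integral_cong, subst nn_integral_multc[symmetric]) (auto simp: ac_simps)
  finally show ?thesis .
qed

lemma nn_integral_push_1:
  assumes [measurable]: "h \<in> borel_measurable M"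
  shows "(\<integral>\<^sup>+w. push h w \<partial>M) = (\<integral>\<^sup>+z. h z \<partial>M)"
  using nn_integral_push[of "\<lambda>_. 1" h] by (simp add: nn_integral_p cong: nn_integral_cong)

lemma push_mono_AE: "AE z in M. g z \<le> h z \<Longrightarrow> push g w \<le> push h w"
  unfolding push_def by (intro nn_integral_mono_AE) (auto elim!: eventually_mono intro: mult_left_mono)

lemma push_cmult:
  "w \<in> space M \<Longrightarrow> h \<in> borel_measurable M \<Longrightarrow> push (\<lambda>z. c * h z) w = c * push h w"
  unfolding push_def
  by (subst nn_integral_cmult[symmetric]) (auto simp: mult.left_commute)

lemma push_add:
  "w \<in> space M \<Longrightarrow> g \<in> borel_measurable M \<Longrightarrow> h \<in> borel_measurable M \<Longrightarrow>
    push (\<lambda>z. g z + h z) w = push g w + push h w"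
  unfolding push_def
  by (subst nn_integral_add[symmetric]) (auto simp: distrib_left)

section \<open>Iterated kernels and accessible sets\<close>

lemma kernel_power_Suc:
  "z \<in> space M \<Longrightarrow> (\<lambda>w. kernel_power (density_kernel M p) n w A) \<in> borel_measurable M \<Longrightarrow>
    kernel_power (density_kernel M p) (Suc n) z A
      = (\<integral>\<^sup>+w. p w z * kernel_power (density_kernel M p) n w A \<partial>M)"
  by (simp add: density_kernel_def nn_integral_density)

lemma kernel_power_measurable[measurable]:
  assumes [measurable]: "A \<in> sets M"
  shows "(\<lambda>z. kernel_power (density_kernel M p) n z A) \<in> borel_measurable M"
proof (induction n)
  case (Suc n)
  note Suc[measurable]
  have "(\<lambda>z. \<integral>\<^sup>+w. p w z * kernel_power (density_kernel M p) n w A \<partial>M) \<in> borel_measurable M"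
    by measurable
  then show ?case
    by (subst measurable_cong[OF kernel_power_Suc[OF _ Suc]])
qed simp

text \<open>Adjointness moves one step of the kernel onto \<open>s\<close>, where invariance absorbs
  it; so n-step probabilities averaged against \<open>s\<close> do not depend on n.\<close>

lemma nn_integral_kernel_power:
  assumes A[measurable]: "A \<in> sets M" and s[measurable]: "s \<in> borel_measurable M"
    and inv: "AE z in M. push s z = s z"
  shows "(\<integral>\<^sup>+z. kernel_power (density_kernel M p) n z A * s z \<partial>M) = (\<integral>\<^sup>+z. indicator A z * s z \<partial>M)"
proof (induction n)
  case (Suc n)
  have "(\<integral>\<^sup>+z. kernel_power (density_kernel M p) (Suc n) z A * s z \<partial>M)
      = (\<integral>\<^sup>+z. (\<integral>\<^sup>+w. p w z * kernel_power (density_kernel M p) n w A \<partial>M) * s z \<partial>M)"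
    by (intro nn_integral_cong) (simp add: kernel_power_Suc del: kernel_power.simps)
  also have "\<dots> = (\<integral>\<^sup>+z. kernel_power (density_kernel M p) n z A * push s z \<partial>M)"
    by (rule nn_integral_push[symmetric]) measurable
  also have "\<dots> = (\<integral>\<^sup>+z. kernel_power (density_kernel M p) n z A * s z \<partial>M)"
    using inv by (intro nn_integral_cong_AE) auto
  finally show ?case using Suc by simp
qed simp

text \<open>If \<open>s\<close> has no mass on \<open>A\<close>, then for every n the probability of
  being in \<open>A\<close> after n steps vanishes wherever \<open>s\<close> is positive, up to a
  null set. Countably many n share one null set, and accessibility supplies an n with positive
  probability at each point.\<close>

lemma AE_eq_0_of_accessible:
  assumes A[measurable]: "A \<in> sets M" and s[measurable]: "s \<in> borel_measurable M"
    and inv: "AE z in M. push s z = s z"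
    and acc: "\<And>z. z \<in> space M \<Longrightarrow> \<exists>n. kernel_power (density_kernel M p) n z A > 0"
    and s0: "AE z in M. z \<in> A \<longrightarrow> s z = 0"
  shows "AE z in M. s z = 0"
proof -
  have "(\<integral>\<^sup>+z. indicator A z * s z \<partial>M) = 0"
    using s0 by (subst nn_integral_0_iff_AE) (auto split: split_indicator)
  then have "AE z in M. kernel_power (density_kernel M p) n z A * s z = 0" for n
    using nn_integral_kernel_power[OF A s inv, of n] by (subst nn_integral_0_iff_AE[symmetric]) auto
  then have "AE z in M. \<forall>n. kernel_power (density_kernel M p) n z A * s z = 0"
    unfolding AE_all_countable by blast
  with AE_space show ?thesis
    by eventually_elim (use acc in fastforce)
qed

text \<open>Subtraction in [0,\<infinity>] is not linear. Instead \<open>r\<close> is written as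
  \<open>t\<close> plus the difference, \<open>push\<close> is applied to the sum, and
  \<open>t\<close> is cancelled where it is finite.\<close>

lemma push_diff:
  assumes [measurable]: "r \<in> borel_measurable M" "t \<in> borel_measurable M"
    and r: "AE z in M. push r z = r z" and t: "AE z in M. push t z = t z"
    and le: "\<And>z. t z \<le> r z" and fin: "AE z in M. t z < \<infinity>"
  shows "AE z in M. push (\<lambda>z. r z - t z) z = r z - t z"
  using AE_space r t fin
proof eventually_elim
  case (elim z)
  have "r = (\<lambda>z. t z + (r z - t z))"
    using le by (auto simp: add_diff_inverse_ennreal)
  then have "push r z = push t z + push (\<lambda>z. r z - t z) z"
    using push_add[of z t "\<lambda>z. r z - t z"] elim by simp
  then have "t z + push (\<lambda>z. r z - t z) z = t z + (r z - t z)"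
    using elim le by (simp add: add_diff_inverse_ennreal)
  then show ?case using elim by (auto simp: ennreal_add_left_cancel)
qed

text \<open>Monotonicity makes the minimum of two fixed points decrease under \<open>push\<close>;
  total mass is preserved and finite, so it cannot decrease on a set of positive measure.\<close>

lemma push_min:
  assumes [measurable]: "a \<in> borel_measurable M" "b \<in> borel_measurable M"
    and a: "AE z in M. push a z = a z" and b: "AE z in M. push b z = b z"
    and fin: "(\<integral>\<^sup>+z. a z \<partial>M) < \<infinity>"
  shows "AE z in M. push (\<lambda>z. min (a z) (b z)) z = min (a z) (b z)"
proof -
  let ?t = "\<lambda>z. min (a z) (b z)"
  have le: "AE z in M. push ?t z \<le> ?t z"
    using a b
  proof eventually_elim
    case (elim z)
    then show ?case using push_mono_AE[of ?t a z] push_mono_AE[of ?t b z] by simp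
  qed
  have "(\<integral>\<^sup>+z. ?t z \<partial>M) \<le> (\<integral>\<^sup>+z. a z \<partial>M)" by (intro nn_integral_mono) simp
  then have f: "(\<integral>\<^sup>+z. push ?t z \<partial>M) \<noteq> \<infinity>"
    using fin by (auto simp: nn_integral_push_1 top_unique)
  have "AE z in M. ?t z \<le> push ?t z"
    using nn_integral_less[OF _ _ f le] nn_integral_push_1[of ?t] by auto
  with le show ?thesis by eventually_elim (rule order.antisym)
qed

text \<open>Densities with respect to a sigma-finite measure are unique almost everywhere, so
  equality of the measures \<open>density M (push r)\<close> and \<open>density M r\<close>
  suffices, even when their mass is infinite.\<close>

lemma push_invariant_density:
  assumes [measurable]: "r \<in> borel_measurable M" and sets: "sets S = sets M"
    and inv: "invariant_measure S (density_kernel M p) (density M r)"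
  shows "AE z in M. push r z = r z"
proof (rule density_unique)
  show "density M (push r) = density M r"
  proof (rule measure_eqI)
    fix A assume "A \<in> sets (density M (push r))"
    then have A[measurable]: "A \<in> sets M" by simp
    have "emeasure (density M (push r)) A = (\<integral>\<^sup>+w. indicator A w * push r w \<partial>M)"
      by (simp add: emeasure_density mult.commute)
    also have "\<dots> = (\<integral>\<^sup>+z. (\<integral>\<^sup>+w. p w z * indicator A w \<partial>M) * r z \<partial>M)"
      by (rule nn_integral_push) measurable
    also have "\<dots> = (\<integral>\<^sup>+z. r z * emeasure (density_kernel M p z) A \<partial>M)"
      by (intro nn_integral_cong) (simp add: density_kernel_def emeasure_density mult.commute)
    also have "\<dots> = (\<integral>\<^sup>+z. emeasure (density_kernel M p z) A \<partial>density M r)"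
    proof (rule nn_integral_density[symmetric])
      have "(\<lambda>z. \<integral>\<^sup>+w. p w z * indicator A w \<partial>M) \<in> borel_measurable M" by measurable
      then show "(\<lambda>z. emeasure (density_kernel M p z) A) \<in> borel_measurable M"
        by (rule measurable_cong[THEN iffD1, rotated])
           (simp add: density_kernel_def emeasure_density)
    qed simp
    also have "\<dots> = emeasure (density M r) A"
      using inv sets by (simp add: invariant_measure_def)
    finally show "emeasure (density M (push r)) A = emeasure (density M r) A" .
  qed simp
qed measurable

text \<open>An invariant measure equals its own image after one step, and such an image is a mixture
  of measures with densities. The mixture has the averaged density \<open>a\<close>.\<close>

lemma invariant_prob_has_density:
  assumes sets: "sets S = sets M" and pi: "prob_space \<pi>"
    and inv: "invariant_measure S (density_kernel M p) \<pi>"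
  obtains a where "a \<in> borel_measurable M" "\<pi> = density M a"
proof -
  interpret pi: prob_space \<pi> by fact
  interpret P: pair_sigma_finite M \<pi> ..
  have sets_pi[measurable_cong]: "sets \<pi> = sets M"
    using inv sets by (simp add: invariant_measure_def)
  note sp = sets_eq_imp_space_eq[OF this]
  define a where "a w = (\<integral>\<^sup>+z. p w z \<partial>\<pi>)" for w
  have [measurable]: "a \<in> borel_measurable M"
    unfolding a_def[abs_def] by measurable
  have "\<pi> = density M a"
  proof (rule measure_eqI)
    fix A assume "A \<in> sets \<pi>"
    then have A[measurable]: "A \<in> sets M" by (simp add: sets_pi)
    have "emeasure (density M a) A = (\<integral>\<^sup>+w. (\<integral>\<^sup>+z. p w z * indicator A w \<partial>\<pi>) \<partial>M)"
      by (simp add: emeasure_density a_def nn_integral_multc cong: nn_integral_cong)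
    also have "\<dots> = (\<integral>\<^sup>+z. (\<integral>\<^sup>+w. p w z * indicator A w \<partial>M) \<partial>\<pi>)"
      by (rule P.Fubini'[symmetric]) measurable
    also have "\<dots> = (\<integral>\<^sup>+z. emeasure (density_kernel M p z) A \<partial>\<pi>)"
      by (intro nn_integral_cong) (simp add: density_kernel_def emeasure_density sp)
    also have "\<dots> = emeasure \<pi> A"
      using inv sets by (simp add: invariant_measure_def)
    finally show "emeasure \<pi> A = emeasure (density M a) A" by simp
  qed (simp add: sets_pi)
  then show thesis by (intro that) auto
qed

text \<open>If \<open>a\<close> and \<open>b\<close> are invariant densities and \<open>\<integral>a < \<infinity>\<close>, then \<open>min a b\<close> is invariant,
  hence so are the two excesses \<open>a - min a b\<close> and \<open>b - min a b\<close>. They live on disjoint sets, one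
  of which is accessible from everywhere, so irreducibility forces one of them to vanish. As
  \<open>\<integral>b = \<infinity>\<close>, it is the first one. Applied to all multiples of \<open>b\<close>, this gives \<open>a = 0\<close>.\<close>

lemma invariant_density_le:
  assumes irr: "irreducible_kernel S (density_kernel M p)" and sets: "sets S = sets M"
    and [measurable]: "a \<in> borel_measurable M" "b \<in> borel_measurable M"
    and a: "AE z in M. push a z = a z" and b: "AE z in M. push b z = b z"
    and fin: "(\<integral>\<^sup>+z. a z \<partial>M) < \<infinity>" and inf: "(\<integral>\<^sup>+z. b z \<partial>M) = \<infinity>"
  shows "AE z in M. a z \<le> b z"
proof -
  let ?t = "\<lambda>z. min (a z) (b z)"
  have sp: "space S = space M" using sets by (rule sets_eq_imp_space_eq)
  have t: "AE z in M. push ?t z = ?t z"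
    by (rule push_min) (use a b fin in auto)
  have af: "AE z in M. a z \<noteq> \<infinity>"
    using fin by (intro nn_integral_PInf_AE) auto
  then have tf: "AE z in M. ?t z < \<infinity>"
    by eventually_elim (auto simp: less_top min_less_iff_disj)
  have s1: "AE z in M. push (\<lambda>z. a z - ?t z) z = a z - ?t z"
    by (rule push_diff) (use a t tf in auto)
  have s2: "AE z in M. push (\<lambda>z. b z - ?t z) z = b z - ?t z"
    by (rule push_diff) (use b t tf in auto)
  obtain \<phi> where phi: "sets \<phi> = sets S" "emeasure \<phi> (space \<phi>) \<noteq> 0"
    "\<And>z A. z \<in> space M \<Longrightarrow> A \<in> sets M \<Longrightarrow> emeasure \<phi> A > 0 \<Longrightarrow> \<exists>n. kernel_power (density_kernel M p) n z A > 0"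
    using irr sets sp unfolding irreducible_kernel_def by metis
  let ?A = "{z\<in>space M. b z < a z}"
  have A[measurable]: "?A \<in> sets M" by measurable
  have "space \<phi> = ?A \<union> (space M - ?A)"
    using sets_eq_imp_space_eq[OF phi(1)] sp by auto
  then have "emeasure \<phi> (space \<phi>) \<le> emeasure \<phi> ?A + emeasure \<phi> (space M - ?A)"
    using emeasure_subadditive[of ?A \<phi> "space M - ?A"] A phi(1) sets by auto
  with phi(2) have "emeasure \<phi> ?A > 0 \<or> emeasure \<phi> (space M - ?A) > 0"
    by (auto simp: zero_less_iff_neq_zero)
  then show ?thesis
  proof
    assume pos: "emeasure \<phi> ?A > 0"
    have "AE z in M. b z - ?t z = 0"
    proof (rule AE_eq_0_of_accessible[OF A _ s2])
      show "AE z in M. z \<in> ?A \<longrightarrow> b z - ?t z = 0"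
      proof (intro AE_I2 impI)
        fix z assume "z \<in> ?A"
        \<comment> \<open>Finiteness matters here because \<open>top - top\<close> is
          \<open>top\<close>; it follows from \<open>b z < a z\<close>.\<close>
        then have "b z \<noteq> top" "?t z = b z" by auto
        then show "b z - ?t z = 0" by (simp add: ennreal_diff_self)
      qed
    qed (use phi(3) pos in auto)
    then have "AE z in M. b z \<le> a z"
      by eventually_elim (auto dest: ennreal_minus_eq_0)
    then have "(\<integral>\<^sup>+z. b z \<partial>M) \<le> (\<integral>\<^sup>+z. a z \<partial>M)" by (rule nn_integral_mono_AE)
    with fin inf show ?thesis by (simp add: top_unique)
  next
    assume pos: "emeasure \<phi> (space M - ?A) > 0"
    have "AE z in M. a z - ?t z = 0"
    proof (rule AE_eq_0_of_accessible[OF _ _ s1])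
      show "AE z in M. z \<in> space M - ?A \<longrightarrow> a z - ?t z = 0"
        using af by eventually_elim (auto simp: min_def not_less)
    qed (use phi(3) pos in auto)
    then show ?thesis
      by eventually_elim (auto dest: ennreal_minus_eq_0)
  qed
qed

lemma not_positive_recurrent:
  assumes sets: "sets S = sets M" and b[measurable]: "b \<in> borel_measurable M"
    and inv: "invariant_measure S (density_kernel M p) (density M b)"
    and fin: "AE z in M. b z < \<infinity>" and inf: "(\<integral>\<^sup>+z. b z \<partial>M) = \<infinity>"
  shows "\<not> positive_recurrent S (density_kernel M p)"
proof
  assume "positive_recurrent S (density_kernel M p)"
  then obtain \<pi> where irr: "irreducible_kernel S (density_kernel M p)" and pi: "prob_space \<pi>"
    and inv_pi: "invariant_measure S (density_kernel M p) \<pi>"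
    by (auto simp: positive_recurrent_def)
  obtain a where a[measurable]: "a \<in> borel_measurable M" and pi_a: "\<pi> = density M a"
    using invariant_prob_has_density[OF sets pi inv_pi] .
  have int_a: "(\<integral>\<^sup>+z. a z \<partial>M) = 1"
    using prob_space.emeasure_space_1[OF pi] by (simp add: pi_a emeasure_density cong: nn_integral_cong)
  have pa: "AE z in M. push a z = a z"
    using push_invariant_density[OF a sets] inv_pi pi_a by simp
  have pb: "AE z in M. push b z = b z"
    using push_invariant_density[OF b sets inv] .
  \<comment> \<open>Scaling \<open>b\<close> by a positive number keeps it invariant and of infinite
    mass, so the bound holds for arbitrarily small multiples; where \<open>b\<close> is finite they
    tend to 0.\<close>
  have "AE z in M. a z \<le> ennreal (inverse (Suc n)) * b z" for n
  proof (rule invariant_density_le[OF irr sets a _ pa])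
    let ?c = "ennreal (inverse (Suc n))"
    show "AE z in M. push (\<lambda>z. ?c * b z) z = ?c * b z"
      using AE_space pb by eventually_elim (simp add: push_cmult)
    show "(\<integral>\<^sup>+z. ?c * b z \<partial>M) = \<infinity>"
      using inf by (simp add: nn_integral_cmult ennreal_mult_eq_top_iff)
  qed (use int_a in auto)
  then have "AE z in M. \<forall>n. a z \<le> ennreal (inverse (Suc n)) * b z"
    by (simp add: AE_all_countable)
  then have "AE z in M. a z = 0"
    using fin
  proof eventually_elim
    case (elim z)
    then obtain r where r: "b z = ennreal r" "0 \<le> r"
      by (cases "b z") auto
    have "(\<lambda>n. ennreal (inverse (Suc n) * r)) \<longlonglongrightarrow> ennreal (0 * r)"
      by (intro tendsto_ennrealI tendsto_mult LIMSEQ_inverse_real_of_nat tendsto_const)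
    moreover have "\<forall>n. a z \<le> ennreal (inverse (Suc n) * r)"
      using elim(1) r by (simp add: ennreal_mult)
    ultimately have "a z \<le> ennreal (0 * r)"
      by (intro LIMSEQ_le_const) auto
    then show ?case by simp
  qed
  then have "(\<integral>\<^sup>+z. a z \<partial>M) = 0" by (simp add: nn_integral_0_iff_AE)
  with int_a show False by simp
qed

end

section \<open>Histories and conditional expectations\<close>

lemma sets_history:
  "sets (history M S Z n) = sigma_sets (space M) (\<Union>i\<le>n. {Z i -` A \<inter> space M | A. A \<in> sets S})"
  unfolding history_def by (rule sets_measure_of) auto

lemma space_history: "space (history M S Z n) = space M"
  unfolding history_def by (rule space_measure_of) auto

lemma subalgebra_history:
  assumes "\<And>i. Z i \<in> measurable M S"
  shows "subalgebra M (history M S Z n)"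
  unfolding subalgebra_def sets_history space_history
  using assms by (auto intro!: sets.sigma_sets_subset measurable_sets)

lemma measurable_history:
  assumes "\<And>i. Z i \<in> measurable M S" "i \<le> n"
  shows "Z i \<in> measurable (history M S Z n) S"
  using assms measurable_space[OF assms(1)]
  by (intro measurableI) (auto simp: sets_history space_history intro!: sigma_sets.Basic)

text \<open>Observing a function of the chain reveals no more than the chain itself. The case of
  interest is \<open>h = fst\<close>, which compares the past of X with the past of (X,G).\<close>

lemma sets_history_comp_subset:
  assumes h: "h \<in> measurable S T" and Z: "\<And>i. Z i \<in> measurable M S"
  shows "sets (history M T (\<lambda>i \<omega>. h (Z i \<omega>)) n) \<subseteq> sets (history M S Z n)"
proof -
  have "(\<lambda>\<omega>. h (Z i \<omega>)) -` A \<inter> space M \<in> sets (history M S Z n)" if "i \<le> n" "A \<in> sets T" for i A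
    using measurable_sets[OF measurable_compose[OF measurable_history[OF Z that(1)] h] that(2)]
    by (simp add: space_history)
  then have "(\<Union>i\<le>n. {(\<lambda>\<omega>. h (Z i \<omega>)) -` A \<inter> space M | A. A \<in> sets T}) \<subseteq> sets (history M S Z n)"
    by auto
  from sets.sigma_sets_subset[OF this] show ?thesis
    by (simp add: sets_history[of M T] space_history)
qed

text \<open>This is the tower property: if the transition probability is already measurable for a
  coarser \<open>F\<close>, conditioning on \<open>F\<close> returns it unchanged. It serves both
  for \<open>F\<close> generated by the present state and for \<open>F\<close> the history of the
  first coordinate.\<close>

lemma markov_chain_nn_cond_exp:
  assumes mc: "markov_chain M S K Z" and A: "A \<in> sets S"
    and F: "subalgebra M F" "sets F \<subseteq> sets (history M S Z n)"
    and q: "q \<in> borel_measurable F" "\<And>\<omega>. \<omega> \<in> space M \<Longrightarrow> q \<omega> = emeasure (K (Z n \<omega>)) A"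
  shows "AE \<omega> in M. nn_cond_exp M F (indicator (Z (Suc n) -` A \<inter> space M)) \<omega> = q \<omega>"
proof -
  interpret prob_space M using mc by (simp add: markov_chain_def)
  have Z[measurable]: "Z i \<in> measurable M S" for i
    using mc by (simp add: markov_chain_def)
  interpret H: finite_measure_subalgebra M "history M S Z n"
    by standard (rule subalgebra_history[OF Z])
  interpret F: finite_measure_subalgebra M F
    by standard (rule F(1))
  let ?I = "indicator (Z (Suc n) -` A \<inter> space M) :: _ \<Rightarrow> ennreal"
  have I[measurable]: "?I \<in> borel_measurable M"
    using measurable_sets[OF Z A] by simp
  have "AE \<omega> in M. q \<omega> = nn_cond_exp M F ?I \<omega>"
  proof (rule F.nn_cond_exp_charact)
    fix B assume B: "B \<in> sets F"
    then have [measurable]: "B \<in> sets (history M S Z n)" using F(2) by auto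
    have "(\<integral>\<^sup>+\<omega>\<in>B. ?I \<omega> \<partial>M) = (\<integral>\<^sup>+\<omega>. indicator B \<omega> * nn_cond_exp M (history M S Z n) ?I \<omega> \<partial>M)"
      by (subst H.nn_cond_exp_intg) (auto simp: mult.commute)
    also have "\<dots> = (\<integral>\<^sup>+\<omega>\<in>B. q \<omega> \<partial>M)"
    proof (rule nn_integral_cong_AE)
      have "AE \<omega> in M. nn_cond_exp M (history M S Z n) ?I \<omega> = emeasure (K (Z n \<omega>)) A"
        using mc A by (simp add: markov_chain_def)
      then show "AE \<omega> in M. indicator B \<omega> * nn_cond_exp M (history M S Z n) ?I \<omega> = q \<omega> * indicator B \<omega>"
        using AE_space by eventually_elim (simp add: q(2) mult.commute)
    qed
    finally show "(\<integral>\<^sup>+\<omega>\<in>B. ?I \<omega> \<partial>M) = (\<integral>\<^sup>+\<omega>\<in>B. q \<omega> \<partial>M)" .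
  qed (use q in auto)
  then show ?thesis by eventually_elim simp
qed

lemma subalgebra_vimage_algebra:
  assumes "V \<in> measurable M S"
  shows "subalgebra M (vimage_algebra (space M) V S)"
  using measurable_sets[OF assms] measurable_space[OF assms]
  by (auto simp: subalgebra_def sets_vimage_algebra2)

lemma sets_vimage_algebra_subset_history:
  assumes Z: "\<And>i. Z i \<in> measurable M S"
  shows "sets (vimage_algebra (space M) (Z n) S) \<subseteq> sets (history M S Z n)"
  using measurable_sets[OF measurable_history[OF Z order_refl]] measurable_space[OF Z]
  by (subst sets_vimage_algebra2) (auto simp: space_history)

section \<open>The PX-DA construction\<close>

locale haar_pxda = X: sigma_finite_measure \<mu>x + Y: sigma_finite_measure \<mu>y
  for \<mu>x :: "'x::{metric_space, second_countable_topology} measure"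
    and \<mu>y :: "'y::{metric_space, second_countable_topology} measure" +
  fixes \<nu> :: "'g::{metric_space, second_countable_topology, topological_group_add} measure"
    and f :: "'x \<Rightarrow> 'y \<Rightarrow> real" and \<phi>x :: "'x \<Rightarrow> real" and \<phi>y :: "'y \<Rightarrow> real"
    and act :: "'g \<Rightarrow> 'y \<Rightarrow> 'y" and j :: "'g \<Rightarrow> 'y \<Rightarrow> real"
  assumes locally_compact_g: "locally compact (UNIV :: 'g set)"
    and sets_x[measurable_cong]: "sets \<mu>x = sets borel"
    and sets_y[measurable_cong]: "sets \<mu>y = sets borel"
    and f: "prob_density (\<mu>x \<Otimes>\<^sub>M \<mu>y) (\<lambda>(x, y). f x y)"
    and \<phi>x: "prob_density \<mu>x \<phi>x" and \<phi>y: "prob_density \<mu>y \<phi>y"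
    and action: "topological_left_action act"
    and jacobian: "action_jacobian \<mu>y act j"
    and haar: "left_haar_measure \<nu>"
    and orbit_mass_pos: "\<And>y. 0 < orbit_mass \<mu>x f act j \<nu> y"
    and orbit_mass_finite: "AE y in \<mu>y. orbit_mass \<mu>x f act j \<nu> y < \<infinity>"
begin

lemma sets_g[measurable_cong]: "sets \<nu> = sets borel"
  using haar by (simp add: left_haar_measure_def)

lemma space_simps[simp]: "space \<mu>x = UNIV" "space \<mu>y = UNIV" "space \<nu> = UNIV"
  using sets_eq_imp_space_eq[OF sets_x] sets_eq_imp_space_eq[OF sets_y]
    sets_eq_imp_space_eq[OF sets_g] by auto

sublocale G: sigma_finite_measure \<nu>
  using haar by (intro sigma_finite_if_finite_on_compacts locally_compact_g sets_g)
    (auto simp: left_haar_measure_def)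

sublocale XY: pair_sigma_finite \<mu>x \<mu>y ..
sublocale XG: pair_sigma_finite \<mu>x \<nu> ..
sublocale YG: pair_sigma_finite \<mu>y \<nu> ..
sublocale Y_XG: pair_sigma_finite \<mu>y "\<mu>x \<Otimes>\<^sub>M \<nu>" ..

lemma sets_xg: "sets (\<mu>x \<Otimes>\<^sub>M \<nu>) = sets borel"
  unfolding borel_prod[symmetric] by (rule sets_pair_measure_cong[OF sets_x sets_g])

abbreviation "fX \<equiv> marginal_x \<mu>y f"
abbreviation "fY \<equiv> marginal_y \<mu>x f"
abbreviation "m \<equiv> orbit_mass \<mu>x f act j \<nu>"
abbreviation "YB \<equiv> Ybar \<mu>x f act j \<nu>"
abbreviation "cx \<equiv> cond_x_given_y \<mu>x f \<phi>x"
abbreviation "cy \<equiv> cond_y_given_x \<mu>y f \<phi>y"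
abbreviation "P \<equiv> pstar_xg \<mu>x \<mu>y f \<phi>y act j \<nu>"
abbreviation "p \<equiv> pstar_x \<mu>x \<mu>y f \<phi>x \<phi>y act j \<nu>"
abbreviation "Q \<equiv> Q_kernel \<mu>x \<mu>y f act j \<nu>"

subsection \<open>Measurability\<close>

lemma f_measurable[measurable (raw)]:
  assumes "u \<in> borel_measurable N" "v \<in> borel_measurable N"
  shows "(\<lambda>z. f (u z) (v z)) \<in> borel_measurable N"
proof -
  have "(\<lambda>(x, y). f x y) \<in> borel_measurable (\<mu>x \<Otimes>\<^sub>M \<mu>y)"
    using f by (simp add: prob_density_def)
  then have "(\<lambda>(x, y). f x y) \<in> borel_measurable (borel \<Otimes>\<^sub>M borel)"
    by (simp only: measurable_cong_sets[OF sets_pair_measure_cong[OF sets_x sets_y] refl])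
  from measurable_compose[OF measurable_Pair[OF assms] this] show ?thesis by simp
qed

lemma act_measurable[measurable (raw)]:
  assumes "u \<in> borel_measurable N" "v \<in> borel_measurable N"
  shows "(\<lambda>z. act (u z) (v z)) \<in> borel_measurable N"
proof -
  have "(\<lambda>(g, y). act g y) \<in> borel_measurable (borel \<Otimes>\<^sub>M borel)"
    using action unfolding borel_prod
    by (intro borel_measurable_continuous_onI) (simp add: topological_left_action_def)
  from measurable_compose[OF measurable_Pair[OF assms] this] show ?thesis by simp
qed

lemma j_measurable[measurable (raw)]:
  assumes "u \<in> borel_measurable N" "v \<in> borel_measurable N"
  shows "(\<lambda>z. j (u z) (v z)) \<in> borel_measurable N"
proof -
  have "(\<lambda>(g, y). j g y) \<in> borel_measurable (borel \<Otimes>\<^sub>M borel)"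
    using jacobian by (simp add: action_jacobian_def)
  from measurable_compose[OF measurable_Pair[OF assms] this] show ?thesis by simp
qed

lemma \<phi>_measurable[measurable]: "\<phi>x \<in> borel_measurable borel" "\<phi>y \<in> borel_measurable borel"
  using \<phi>x \<phi>y by (simp_all add: prob_density_def measurable_cong_sets[OF sets_x refl]
      measurable_cong_sets[OF sets_y refl])

lemma f_nonneg[simp]: "0 \<le> f x y"
  using f by (simp add: prob_density_def space_pair_measure)

lemma j_pos[simp]: "0 < j g y"
  using jacobian by (simp add: action_jacobian_def)

lemma j_neq_0[simp]: "j g y \<noteq> 0"
  using j_pos[of g y] by linarith

lemma j_nonneg[simp]: "0 \<le> j g y"
  by (rule less_imp_le[OF j_pos])

lemma marginal_measurable[measurable]: "fX \<in> borel_measurable borel" "fY \<in> borel_measurable borel"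
  unfolding marginal_x_def[abs_def] marginal_y_def[abs_def] by measurable

lemma m_measurable[measurable]: "m \<in> borel_measurable borel"
  unfolding orbit_mass_def[abs_def] by measurable

lemma YB_measurable[measurable]: "YB \<in> sets borel"
  unfolding Ybar_def by measurable

lemma cx_measurable[measurable (raw)]:
  assumes [measurable]: "u \<in> borel_measurable N" "v \<in> borel_measurable N"
  shows "(\<lambda>z. cx (u z) (v z)) \<in> borel_measurable N"
  unfolding cond_x_given_y_def by measurable

lemma cy_measurable[measurable (raw)]:
  assumes [measurable]: "u \<in> borel_measurable N" "v \<in> borel_measurable N"
  shows "(\<lambda>z. cy (u z) (v z)) \<in> borel_measurable N"
  unfolding cond_y_given_x_def by measurable

subsection \<open>The action\<close>

lemma act_add: "act (g + h) y = act g (act h y)"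
  using action by (simp add: topological_left_action_def)

lemma j_add: "j (g + h) y = j g (act h y) * j h y"
  using jacobian by (simp add: action_jacobian_def)

lemma nn_integral_act:
  assumes [measurable]: "h \<in> borel_measurable borel"
  shows "(\<integral>\<^sup>+y. h (act g y) * ennreal (j g y) \<partial>\<mu>y) = (\<integral>\<^sup>+y. h y \<partial>\<mu>y)"
proof (rule nn_integral_eq_if_has_bochner_integral_eq[OF Y.sigma_finite_measure_axioms])
  fix h :: "'y \<Rightarrow> real" assume "integrable \<mu>y h"
  then show "has_bochner_integral \<mu>y (\<lambda>y. h (act g y) * j g y) (\<integral>y. h y \<partial>\<mu>y)"
    using jacobian by (simp add: action_jacobian_def)
qed auto

text \<open>The action maps null sets to null sets: change variables in the indicator of the
  exceptional set and use \<open>j > 0\<close>.\<close>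

lemma AE_act:
  assumes "AE y in \<mu>y. R y" and [measurable]: "Measurable.pred borel R"
  shows "AE y in \<mu>y. R (act g y)"
proof -
  have "(\<integral>\<^sup>+y. indicator {y. \<not> R y} (act g y) * ennreal (j g y) \<partial>\<mu>y) = (\<integral>\<^sup>+y. indicator {y. \<not> R y} y \<partial>\<mu>y)"
    by (intro nn_integral_act) measurable
  also have "\<dots> = 0"
    using assms by (subst nn_integral_0_iff_AE) (auto split: split_indicator)
  finally show ?thesis
    by (subst (asm) nn_integral_0_iff_AE) (auto split: split_indicator_asm elim!: eventually_mono)
qed

lemma nn_integral_left_translate:
  assumes [measurable]: "h \<in> borel_measurable borel"
  shows "(\<integral>\<^sup>+g. h (a + g) \<partial>\<nu>) = (\<integral>\<^sup>+g. h g \<partial>\<nu>)"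
  using nn_integral_eq_if_has_bochner_integral_eq[of \<nu> "\<lambda>g. a + g" "\<lambda>_. 1" h]
    G.sigma_finite_measure_axioms haar by (simp add: left_haar_measure_def)

text \<open>A common form for \<open>m\<close>, with \<open>h = fY\<close>, and for the orbit
  integral of \<open>f x\<close>, so that both are seen to scale by the same factor along an
  orbit.\<close>

definition orbit_integral :: "('y \<Rightarrow> ennreal) \<Rightarrow> 'y \<Rightarrow> ennreal" where
  "orbit_integral h y = (\<integral>\<^sup>+g. h (act g y) * ennreal (j g y) \<partial>\<nu>)"

lemma orbit_mass_eq: "m y = orbit_integral fY y"
  by (simp add: orbit_mass_def orbit_integral_def)

text \<open>A right translation of \<open>\<nu>\<close> is a constant multiple of \<open>\<nu>\<close>, so all orbit integrals change by
  the same factor along an orbit, and their ratios are invariant.\<close>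

lemma orbit_integral_act:
  obtains c where "0 < c" "c < \<infinity>"
    "\<And>h. h \<in> borel_measurable borel \<Longrightarrow> orbit_integral h (act a y) = c * orbit_integral h y"
proof -
  have \<nu>0: "emeasure \<nu> UNIV \<noteq> 0" using haar by (simp add: left_haar_measure_def)
  obtain k where k: "0 < k" "k < \<infinity>"
    "\<And>h. h \<in> borel_measurable borel \<Longrightarrow> (\<integral>\<^sup>+x. h (x + a) \<partial>\<nu>) = k * (\<integral>\<^sup>+x. h x \<partial>\<nu>)"
    by (rule left_invariant_right_translation[OF G.sigma_finite_measure_axioms sets_g
          nn_integral_left_translate \<nu>0]) auto
  show thesis
  \<comment> \<open>The cocycle rule gives \<open>j g (act a y) = j (g + a) y / j a y\<close>; the
    denominator is the first factor, and undoing the right translation by \<open>a\<close> yields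
    \<open>k\<close>.\<close>
  proof (rule that[of "ennreal (1 / j a y) * k"])
    show "0 < ennreal (1 / j a y) * k" using k by (simp add: ennreal_zero_less_mult_iff)
    show "ennreal (1 / j a y) * k < \<infinity>" using k by (simp add: ennreal_mult_less_top)
    fix h :: "'y \<Rightarrow> ennreal" assume [measurable]: "h \<in> borel_measurable borel"
    have "ennreal (j g (act a y)) = ennreal (1 / j a y) * ennreal (j (g + a) y)" for g
      by (simp add: j_add ennreal_mult[symmetric])
    then have "orbit_integral h (act a y)
        = (\<integral>\<^sup>+g. ennreal (1 / j a y) * (h (act (g + a) y) * ennreal (j (g + a) y)) \<partial>\<nu>)"
      unfolding orbit_integral_def
      by (intro nn_integral_cong) (simp only: act_add mult.left_commute)
    also have "\<dots> = ennreal (1 / j a y) * (\<integral>\<^sup>+g. h (act (g + a) y) * ennreal (j (g + a) y) \<partial>\<nu>)"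
      by (intro nn_integral_cmult) measurable
    also have "\<dots> = ennreal (1 / j a y) * k * orbit_integral h y"
      using k(3)[of "\<lambda>g. h (act g y) * ennreal (j g y)"] by (simp add: orbit_integral_def mult.assoc)
    finally show "orbit_integral h (act a y) = ennreal (1 / j a y) * k * orbit_integral h y" .
  qed
qed

subsection \<open>Marginals and conditionals\<close>

lemma nn_integral_fX: "(\<integral>\<^sup>+x. fX x \<partial>\<mu>x) = 1"
  using f Y.nn_integral_fst[of "\<lambda>(x, y). ennreal (f x y)" \<mu>x]
  by (simp add: prob_density_def marginal_x_def split_beta')

lemma nn_integral_fY: "(\<integral>\<^sup>+y. fY y \<partial>\<mu>y) = 1"
  using XY.Fubini'[of "\<lambda>x y. ennreal (f x y)"] nn_integral_fX
  by (simp add: marginal_y_def marginal_x_def)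

lemma fX_finite: "AE x in \<mu>x. fX x < \<infinity>"
  using nn_integral_PInf_AE[of fX \<mu>x] nn_integral_fX by (simp add: less_top)

lemma nn_integral_divide_ennreal:
  "h \<in> borel_measurable N \<Longrightarrow> (\<integral>\<^sup>+x. h x / (c :: ennreal) \<partial>N) = (\<integral>\<^sup>+x. h x \<partial>N) / c"
  unfolding divide_ennreal_def by (rule nn_integral_multc)

lemma nn_integral_cx: "(\<integral>\<^sup>+x. cx x y \<partial>\<mu>x) = 1"
proof (cases "0 < fY y \<and> fY y < \<infinity>")
  case True
  then show ?thesis
    using ennreal_divide_self[of "fY y"]
    by (auto simp: cond_x_given_y_def nn_integral_divide_ennreal simp flip: marginal_y_def)
next
  case False
  show ?thesis using \<phi>x by (simp only: cond_x_given_y_def if_not_P[OF False] prob_density_def)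
qed

lemma nn_integral_cy: "(\<integral>\<^sup>+y. cy y x \<partial>\<mu>y) = 1"
proof (cases "0 < fX x \<and> fX x < \<infinity>")
  case True
  then show ?thesis
    using ennreal_divide_self[of "fX x"]
    by (auto simp: cond_y_given_x_def nn_integral_divide_ennreal simp flip: marginal_x_def)
next
  case False
  show ?thesis using \<phi>y by (simp only: cond_y_given_x_def if_not_P[OF False] prob_density_def)
qed

text \<open>The default density is harmless: where \<open>fY y = 0\<close> it is multiplied by 0,
  and \<open>f x y\<close> vanishes as well, though only for almost every x.\<close>

lemma cx_mult_fY:
  assumes "fY y < \<infinity>" shows "AE x in \<mu>x. cx x y * fY y = ennreal (f x y)"
proof (cases "fY y = 0")
  case True
  then have "AE x in \<mu>x. ennreal (f x y) = 0"
    unfolding marginal_y_def by (subst (asm) nn_integral_0_iff_AE) auto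
  then show ?thesis by eventually_elim (simp add: True)
next
  case False
  then have "cx x y * fY y = ennreal (f x y)" for x
    using assms by (simp add: cond_x_given_y_def zero_less_iff_neq_zero ennreal_divide_times)
  then show ?thesis by simp
qed

lemma cy_mult_fX:
  assumes "fX x < \<infinity>" shows "AE y in \<mu>y. cy y x * fX x = ennreal (f x y)"
proof (cases "fX x = 0")
  case True
  then have "AE y in \<mu>y. ennreal (f x y) = 0"
    unfolding marginal_x_def by (subst (asm) nn_integral_0_iff_AE) auto
  then show ?thesis by eventually_elim (simp add: True)
next
  case False
  then have "cy y x * fX x = ennreal (f x y)" for y
    using assms by (simp add: cond_y_given_x_def zero_less_iff_neq_zero ennreal_divide_times)
  then show ?thesis by simp
qed

section \<open>Marginals and formal conditionals of \<open>fhat\<close>\<close>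

lemma nn_integral_fhat_x: "(\<integral>\<^sup>+x. ennreal (fhat f act j x y g) \<partial>\<mu>x) = fY (act g y) * ennreal (j g y)"
  by (simp add: fhat_def ennreal_mult nn_integral_multc marginal_y_def)

lemma nn_integral_fhat_y: "(\<integral>\<^sup>+y. ennreal (fhat f act j x y g) \<partial>\<mu>y) = fX x"
  using nn_integral_act[of "\<lambda>y. ennreal (f x y)" g]
  by (simp add: fhat_def ennreal_mult marginal_x_def)

text \<open>Changing variables turns the denominator into \<open>fX x\<close>, so both sides branch
  on the same condition. The default branch of \<open>fhat_y_given_xg\<close> is the translate of
  \<open>\<phi>y\<close>, which makes the identity hold without exception.\<close>

lemma fhat_y_given_xg_eq:
  "fhat_y_given_xg \<mu>y f act j \<phi>y y (x, g) = cy (act g y) x * ennreal (j g y)"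
proof (cases "0 < fX x \<and> fX x < \<infinity>")
  case True
  show ?thesis
    by (simp only: fhat_y_given_xg_def case_prod_conv nn_integral_fhat_y cond_y_given_x_def Let_def
        if_P[OF True]) (simp add: fhat_def ennreal_mult divide_ennreal_def mult_ac)
next
  case False
  have "0 \<le> \<phi>y (act g y)" using \<phi>y by (simp add: prob_density_def)
  then show ?thesis
    by (simp only: fhat_y_given_xg_def case_prod_conv nn_integral_fhat_y cond_y_given_x_def Let_def
        if_not_P[OF False] ennreal_mult[OF _ j_nonneg])
qed

lemma fhat_xg_given_y_eq:
  "fhat_xg_given_y \<mu>x f act j \<nu> (x, g) y = ennreal (f x (act g y) * j g y) / m y"
  by (simp add: fhat_xg_given_y_def nn_integral_fhat_x orbit_mass_def) (simp add: fhat_def)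

lemma nn_integral_fhat:
  "(\<integral>\<^sup>+g. (\<integral>\<^sup>+y. (\<integral>\<^sup>+x. ennreal (fhat f act j x y g) \<partial>\<mu>x) \<partial>\<mu>y) \<partial>\<nu>) = emeasure \<nu> UNIV"
  by (simp add: nn_integral_fhat_x nn_integral_act nn_integral_fY)

lemma fhat_not_normalizable:
  assumes inf: "emeasure \<nu> UNIV = \<infinity>"
  shows "\<not> prob_density (\<mu>x \<Otimes>\<^sub>M (\<mu>y \<Otimes>\<^sub>M \<nu>)) (\<lambda>(x, y, g). c * fhat f act j x y g)"
proof
  interpret X_YG: pair_sigma_finite \<mu>x "\<mu>y \<Otimes>\<^sub>M \<nu>" ..
  let ?N = "\<mu>x \<Otimes>\<^sub>M (\<mu>y \<Otimes>\<^sub>M \<nu>)" and ?h = "\<lambda>(x, y, g). ennreal (fhat f act j x y g)"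
  assume d: "prob_density ?N (\<lambda>(x, y, g). c * fhat f act j x y g)"
  have [measurable]: "?h \<in> borel_measurable ?N"
    unfolding fhat_def by measurable
  have "(\<integral>\<^sup>+z. ?h z \<partial>?N) = (\<integral>\<^sup>+(y, g). (\<integral>\<^sup>+x. ennreal (fhat f act j x y g) \<partial>\<mu>x) \<partial>(\<mu>y \<Otimes>\<^sub>M \<nu>))"
    by (subst X_YG.nn_integral_snd[symmetric]) (auto simp: split_beta' fhat_def)
  also have "\<dots> = (\<integral>\<^sup>+g. (\<integral>\<^sup>+y. (\<integral>\<^sup>+x. ennreal (fhat f act j x y g) \<partial>\<mu>x) \<partial>\<mu>y) \<partial>\<nu>)"
    by (subst YG.nn_integral_snd[symmetric]) (auto simp: fhat_def)
  finally have h: "(\<integral>\<^sup>+z. ?h z \<partial>?N) = \<infinity>"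
    using nn_integral_fhat inf by simp
  have "(\<integral>\<^sup>+z. ennreal (case z of (x, y, g) \<Rightarrow> c * fhat f act j x y g) \<partial>?N) = (\<integral>\<^sup>+z. ennreal c * ?h z \<partial>?N)"
    by (intro nn_integral_cong) (auto simp: ennreal_mult'' fhat_def)
  also have "\<dots> = ennreal c * \<infinity>"
    by (subst nn_integral_cmult) (auto simp: h)
  \<comment> \<open>\<open>ennreal c * \<infinity>\<close> is 0 for \<open>c \<le> 0\<close> and
    infinite otherwise, hence never 1.\<close>
  finally show False
    using d by (simp add: prob_density_def ennreal_mult_top split: if_splits)
qed

subsection \<open>The chain on the product space\<close>

lemma P_eq:
  "P z z' = (\<integral>\<^sup>+y. ennreal (f (fst z) (act (snd z) y) * j (snd z) y) / m y * indicator YB y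
    * (cy (act (snd z') y) (fst z') * ennreal (j (snd z') y)) \<partial>\<mu>y)"
  unfolding pstar_xg_def
  by (cases z, cases z', intro nn_integral_cong)
     (simp add: fhat_y_given_xg_eq fhat_xg_given_y_eq mult_ac)

lemma P_measurable[measurable (raw)]:
  assumes [measurable]: "u \<in> measurable N (borel \<Otimes>\<^sub>M borel)" "v \<in> measurable N (borel \<Otimes>\<^sub>M borel)"
  shows "(\<lambda>z. P (u z) (v z)) \<in> borel_measurable N"
  unfolding P_eq by measurable

lemma P_measurable_fst: "(\<lambda>z. P z z') \<in> borel_measurable (\<mu>x \<Otimes>\<^sub>M \<nu>)"
  by (rule P_measurable) (auto simp: space_pair_measure)

text \<open>The expectation of \<open>u\<close> under \<open>fhat_xg_given_y\<close> at
  \<open>y\<close>, set to 0 outside \<open>YB\<close>.\<close>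

definition y_weight :: "('x \<times> 'g \<Rightarrow> ennreal) \<Rightarrow> 'y \<Rightarrow> ennreal" where
  "y_weight u y = (\<integral>\<^sup>+z. u z * ennreal (f (fst z) (act (snd z) y) * j (snd z) y) \<partial>(\<mu>x \<Otimes>\<^sub>M \<nu>))
     / m y * indicator YB y"

lemma y_weight_measurable[measurable]:
  assumes [measurable]: "u \<in> borel_measurable (borel \<Otimes>\<^sub>M borel)"
  shows "y_weight u \<in> borel_measurable borel"
  unfolding y_weight_def[abs_def] by measurable

text \<open>A step of the chain draws y from (x',g') and then the new pair from y. Tonelli puts the
  expectation over the second draw inside.\<close>

lemma nn_integral_P:
  assumes [measurable]: "u \<in> borel_measurable (borel \<Otimes>\<^sub>M borel)"
  shows "(\<integral>\<^sup>+z. u z * P z (x', g') \<partial>(\<mu>x \<Otimes>\<^sub>M \<nu>))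
    = (\<integral>\<^sup>+y. y_weight u y * (cy (act g' y) x' * ennreal (j g' y)) \<partial>\<mu>y)"
proof -
  let ?k = "\<lambda>y z. u z * ennreal (f (fst z) (act (snd z) y) * j (snd z) y)"
  let ?c = "\<lambda>y. inverse (m y) * indicator YB y * (cy (act g' y) x' * ennreal (j g' y))"
  have "(\<integral>\<^sup>+z. u z * P z (x', g') \<partial>(\<mu>x \<Otimes>\<^sub>M \<nu>))
    = (\<integral>\<^sup>+z. (\<integral>\<^sup>+y. ?k y z * ?c y \<partial>\<mu>y) \<partial>(\<mu>x \<Otimes>\<^sub>M \<nu>))"
    unfolding P_eq
    by (intro nn_integral_cong, subst nn_integral_cmult[symmetric])
       (auto simp: divide_ennreal_def mult_ac)
  also have "\<dots> = (\<integral>\<^sup>+y. (\<integral>\<^sup>+z. ?k y z * ?c y \<partial>(\<mu>x \<Otimes>\<^sub>M \<nu>)) \<partial>\<mu>y)"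
    by (rule Y_XG.Fubini') measurable
  also have "\<dots> = (\<integral>\<^sup>+y. (\<integral>\<^sup>+z. ?k y z \<partial>(\<mu>x \<Otimes>\<^sub>M \<nu>)) * ?c y \<partial>\<mu>y)"
    by (intro nn_integral_cong nn_integral_multc) measurable
  also have "\<dots> = (\<integral>\<^sup>+y. y_weight u y * (cy (act g' y) x' * ennreal (j g' y)) \<partial>\<mu>y)"
    by (intro nn_integral_cong) (simp add: y_weight_def divide_ennreal_def mult.assoc)
  finally show ?thesis .
qed

lemma nn_integral_xg:
  "(\<integral>\<^sup>+z. ennreal (f (fst z) (act (snd z) y) * j (snd z) y) \<partial>(\<mu>x \<Otimes>\<^sub>M \<nu>)) = m y"
proof -
  have "(\<integral>\<^sup>+z. ennreal (f (fst z) (act (snd z) y) * j (snd z) y) \<partial>(\<mu>x \<Otimes>\<^sub>M \<nu>))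
    = (\<integral>\<^sup>+g. (\<integral>\<^sup>+x. ennreal (fhat f act j x y g) \<partial>\<mu>x) \<partial>\<nu>)"
    by (subst XG.nn_integral_snd[symmetric]) (auto simp: fhat_def)
  then show ?thesis by (simp add: nn_integral_fhat_x orbit_mass_def)
qed

lemma m_divide_self: "y \<in> YB \<Longrightarrow> m y / m y = 1"
  using orbit_mass_pos[of y] by (intro ennreal_divide_self) (auto simp: Ybar_def)

lemma AE_YB: "AE y in \<mu>y. y \<in> YB"
  using orbit_mass_finite by (simp add: Ybar_def)

lemma transition_density_P: "transition_density (\<mu>x \<Otimes>\<^sub>M \<nu>) P"
  unfolding transition_density_def
proof (intro conjI ballI)
  show "(\<lambda>(z, z'). P z z') \<in> borel_measurable ((\<mu>x \<Otimes>\<^sub>M \<nu>) \<Otimes>\<^sub>M (\<mu>x \<Otimes>\<^sub>M \<nu>))"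
    by (subst measurable_cong_sets[OF sets_pair_measure_cong[OF
          sets_pair_measure_cong[OF sets_x sets_g] sets_pair_measure_cong[OF sets_x sets_g]] refl])
       measurable
  fix z' :: "'x \<times> 'g"
  obtain x' g' where z': "z' = (x', g')" by (cases z')
  have "(\<integral>\<^sup>+z. P z z' \<partial>(\<mu>x \<Otimes>\<^sub>M \<nu>))
    = (\<integral>\<^sup>+y. y_weight (\<lambda>_. 1) y * (cy (act g' y) x' * ennreal (j g' y)) \<partial>\<mu>y)"
    using nn_integral_P[of "\<lambda>_. 1" x' g'] by (simp add: z')
  also have "\<dots> = (\<integral>\<^sup>+y. cy (act g' y) x' * ennreal (j g' y) \<partial>\<mu>y)"
    using AE_YB by (intro nn_integral_cong_AE) (auto elim!: eventually_mono simp: y_weight_def nn_integral_xg m_divide_self)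
  also have "\<dots> = 1"
    using nn_integral_act[of "\<lambda>y. cy y x'" g'] by (simp add: nn_integral_cy)
  finally show "(\<integral>\<^sup>+z. P z z' \<partial>(\<mu>x \<Otimes>\<^sub>M \<nu>)) = 1" .
qed

lemma density_fX_pair: "density \<mu>x fX \<Otimes>\<^sub>M \<nu> = density (\<mu>x \<Otimes>\<^sub>M \<nu>) (\<lambda>z. fX (fst z))"
proof -
  have "density \<mu>x fX \<Otimes>\<^sub>M density \<nu> (\<lambda>_. 1) = density (\<mu>x \<Otimes>\<^sub>M \<nu>) (\<lambda>(x, g). fX x * 1)"
    by (rule pair_measure_density) (auto simp: density_1 G.sigma_finite_measure_axioms)
  then show ?thesis by (simp add: density_1 split_beta')
qed

lemma nn_integral_cy_mult_fX:
  assumes [measurable]: "h \<in> borel_measurable borel" and "fX x < \<infinity>"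
  shows "(\<integral>\<^sup>+y. h y * (cy (act g y) x * ennreal (j g y)) * fX x \<partial>\<mu>y)
    = (\<integral>\<^sup>+y. h y * ennreal (f x (act g y) * j g y) \<partial>\<mu>y)"
proof (rule nn_integral_cong_AE)
  have "AE y in \<mu>y. cy (act g y) x * fX x = ennreal (f x (act g y))"
    using cy_mult_fX[OF assms(2)] by (rule AE_act) measurable
  then show "AE y in \<mu>y. h y * (cy (act g y) x * ennreal (j g y)) * fX x = h y * ennreal (f x (act g y) * j g y)"
  proof eventually_elim
    case (elim y)
    have "h y * (cy (act g y) x * ennreal (j g y)) * fX x = h y * (cy (act g y) x * fX x * ennreal (j g y))"
      by (simp only: mult_ac)
    then show ?case by (simp add: elim ennreal_mult)
  qed
qed

lemma invariant_P:
  "invariant_measure borel (density_kernel (\<mu>x \<Otimes>\<^sub>M \<nu>) P) (density \<mu>x fX \<Otimes>\<^sub>M \<nu>)"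
  unfolding invariant_measure_def density_fX_pair
proof (intro conjI ballI)
  show "sets (density (\<mu>x \<Otimes>\<^sub>M \<nu>) (\<lambda>z. fX (fst z))) = sets borel" by (simp add: sets_xg)
  fix A :: "('x \<times> 'g) set" assume "A \<in> sets borel"
  then have [measurable]: "A \<in> sets (borel \<Otimes>\<^sub>M borel)" unfolding borel_prod .
  let ?xg = "\<mu>x \<Otimes>\<^sub>M \<nu>"
  let ?u = "indicator A :: _ \<Rightarrow> ennreal"
  let ?F = "\<lambda>y z. ennreal (f (fst z) (act (snd z) y) * j (snd z) y)"
  have K: "emeasure (density_kernel ?xg P z') A
      = (\<integral>\<^sup>+y. y_weight ?u y * (cy (act (snd z') y) (fst z') * ennreal (j (snd z') y)) \<partial>\<mu>y)" for z'
  proof -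
    have "emeasure (density_kernel ?xg P z') A = (\<integral>\<^sup>+z. P z z' * ?u z \<partial>?xg)"
      unfolding density_kernel_def
      using \<open>A \<in> sets borel\<close> by (intro emeasure_density P_measurable_fst) (simp add: sets_xg)
    also have "\<dots> = (\<integral>\<^sup>+z. ?u z * P z (fst z', snd z') \<partial>?xg)"
      by (simp add: mult.commute)
    also have "\<dots> = (\<integral>\<^sup>+y. y_weight ?u y * (cy (act (snd z') y) (fst z') * ennreal (j (snd z') y)) \<partial>\<mu>y)"
      by (rule nn_integral_P) measurable
    finally show ?thesis .
  qed
  have "(\<integral>\<^sup>+z'. emeasure (density_kernel ?xg P z') A \<partial>density ?xg (\<lambda>z. fX (fst z)))
    = (\<integral>\<^sup>+z'. (\<integral>\<^sup>+y. y_weight ?u y * (cy (act (snd z') y) (fst z') * ennreal (j (snd z') y)) * fX (fst z') \<partial>\<mu>y) \<partial>?xg)"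
    unfolding K
    by (subst nn_integral_density, measurable)
       (intro nn_integral_cong, subst nn_integral_multc, auto simp: mult.commute)
  also have "\<dots> = (\<integral>\<^sup>+z'. (\<integral>\<^sup>+y. y_weight ?u y * ?F y z' \<partial>\<mu>y) \<partial>?xg)"
  proof (rule nn_integral_cong_AE)
    have "AE z in ?xg. fX (fst z) < \<infinity>"
      using fX_finite by (subst XG.AE_pair_iff[symmetric]) auto
    then show "AE z' in ?xg. (\<integral>\<^sup>+y. y_weight ?u y * (cy (act (snd z') y) (fst z') * ennreal (j (snd z') y)) * fX (fst z') \<partial>\<mu>y)
        = (\<integral>\<^sup>+y. y_weight ?u y * ?F y z' \<partial>\<mu>y)"
      by eventually_elim (rule nn_integral_cy_mult_fX, auto)
  qed
  also have "\<dots> = (\<integral>\<^sup>+y. (\<integral>\<^sup>+z'. y_weight ?u y * ?F y z' \<partial>?xg) \<partial>\<mu>y)"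
    by (rule Y_XG.Fubini') measurable
  \<comment> \<open>Integrating over the old state yields \<open>m y\<close>, which cancels the
    denominator of \<open>y_weight\<close> on \<open>YB\<close>, that is, for almost every
    y.\<close>
  also have "\<dots> = (\<integral>\<^sup>+y. y_weight ?u y * m y \<partial>\<mu>y)"
    by (simp add: nn_integral_cmult nn_integral_xg)
  also have "\<dots> = (\<integral>\<^sup>+y. (\<integral>\<^sup>+z. ?u z * ?F y z \<partial>?xg) \<partial>\<mu>y)"
    using AE_YB
  proof (intro nn_integral_cong_AE, eventually_elim)
    case (elim y)
    then show ?case
      using m_divide_self[of y] by (simp add: y_weight_def ennreal_divide_times)
  qed
  also have "\<dots> = (\<integral>\<^sup>+z. (\<integral>\<^sup>+y. ?u z * ?F y z \<partial>\<mu>y) \<partial>?xg)"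
    by (rule Y_XG.Fubini'[symmetric]) measurable
  also have "\<dots> = (\<integral>\<^sup>+z. ?u z * fX (fst z) \<partial>?xg)"
    using nn_integral_fhat_y by (simp add: nn_integral_cmult fhat_def)
  also have "\<dots> = emeasure (density ?xg (\<lambda>z. fX (fst z))) A"
    by (simp add: emeasure_density mult.commute)
  finally show "(\<integral>\<^sup>+z'. emeasure (density_kernel ?xg P z') A \<partial>density ?xg (\<lambda>z. fX (fst z)))
    = emeasure (density ?xg (\<lambda>z. fX (fst z))) A" .
qed

lemma emeasure_invariant: "emeasure (density \<mu>x fX \<Otimes>\<^sub>M \<nu>) UNIV = emeasure \<nu> UNIV"
proof -
  have "emeasure (density \<mu>x fX \<Otimes>\<^sub>M \<nu>) (UNIV \<times> UNIV) = emeasure (density \<mu>x fX) UNIV * emeasure \<nu> UNIV"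
    by (rule G.emeasure_pair_measure_Times) (simp_all add: sets_x sets_g)
  then show ?thesis by (simp add: emeasure_density nn_integral_fX sets_x)
qed

sublocale chain: density_chain "\<mu>x \<Otimes>\<^sub>M \<nu>" P
  by standard (rule transition_density_P)

lemma not_positive_recurrent_P:
  assumes "emeasure \<nu> UNIV = \<infinity>"
  shows "\<not> positive_recurrent borel (density_kernel (\<mu>x \<Otimes>\<^sub>M \<nu>) P)"
proof (rule chain.not_positive_recurrent)
  show "sets borel = sets (\<mu>x \<Otimes>\<^sub>M \<nu>)" by (simp add: sets_xg)
  show "invariant_measure borel (density_kernel (\<mu>x \<Otimes>\<^sub>M \<nu>) P) (density (\<mu>x \<Otimes>\<^sub>M \<nu>) (\<lambda>z. fX (fst z)))"
    using invariant_P by (simp add: density_fX_pair)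
  show "AE z in \<mu>x \<Otimes>\<^sub>M \<nu>. fX (fst z) < \<infinity>"
    using fX_finite by (subst XG.AE_pair_iff[symmetric]) auto
  show "(\<integral>\<^sup>+z. fX (fst z) \<partial>(\<mu>x \<Otimes>\<^sub>M \<nu>)) = \<infinity>"
    using emeasure_invariant assms
    by (simp add: density_fX_pair emeasure_density sets_xg)
qed measurable

subsection \<open>The marginal chain\<close>

text \<open>The x-marginal of \<open>fhat_xg_given_y\<close> on \<open>YB\<close>: the variable g
  has been integrated out. Outside \<open>YB\<close> it is 0.\<close>

definition x_ratio :: "'x \<Rightarrow> 'y \<Rightarrow> ennreal" where
  "x_ratio x y = orbit_integral (\<lambda>y. ennreal (f x y)) y / m y * indicator YB y"

lemma x_ratio_measurable[measurable (raw)]: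
  assumes [measurable]: "u \<in> borel_measurable N" "v \<in> borel_measurable N"
  shows "(\<lambda>z. x_ratio (u z) (v z)) \<in> borel_measurable N"
  unfolding x_ratio_def orbit_integral_def by measurable

lemma x_ratio_act: "x_ratio x (act a y) = x_ratio x y"
proof -
  obtain c where c: "0 < c" "c < \<infinity>"
    "\<And>h. h \<in> borel_measurable borel \<Longrightarrow> orbit_integral h (act a y) = c * orbit_integral h y"
    using orbit_integral_act[of a y] by blast
  have m: "m (act a y) = m y * c"
    by (simp add: orbit_mass_eq c(3) mult.commute)
  \<comment> \<open>As the factor lies in (0,\<infinity>), \<open>YB\<close> is a union of orbits,
    so the cutoff is invariant as well.\<close>
  then have "indicator YB (act a y) = (indicator YB y :: ennreal)"
    using c(1,2) by (auto simp: Ybar_def indicator_def ennreal_mult_less_top)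
  moreover have "orbit_integral (\<lambda>y. ennreal (f x y)) (act a y) / m (act a y)
      = orbit_integral (\<lambda>y. ennreal (f x y)) y / m y"
    using c(1,2) unfolding m by (subst c(3)) (auto simp: divide_mult_eq mult.commute[of c])
  ultimately show ?thesis by (simp add: x_ratio_def)
qed

lemma nn_integral_P_g: "(\<integral>\<^sup>+g. P (x, g) (x', g') \<partial>\<nu>) = (\<integral>\<^sup>+y. x_ratio x y * cy y x' \<partial>\<mu>y)"
proof -
  let ?k = "\<lambda>y g. ennreal (f x (act g y)) * ennreal (j g y)"
  let ?c = "\<lambda>y. inverse (m y) * indicator YB y * (cy (act g' y) x' * ennreal (j g' y))"
  have "(\<integral>\<^sup>+g. P (x, g) (x', g') \<partial>\<nu>) = (\<integral>\<^sup>+g. (\<integral>\<^sup>+y. ?k y g * ?c y \<partial>\<mu>y) \<partial>\<nu>)"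
    unfolding P_eq by (intro nn_integral_cong) (simp add: ennreal_mult divide_ennreal_def mult.assoc)
  also have "\<dots> = (\<integral>\<^sup>+y. (\<integral>\<^sup>+g. ?k y g * ?c y \<partial>\<nu>) \<partial>\<mu>y)"
    by (rule YG.Fubini') measurable
  also have "\<dots> = (\<integral>\<^sup>+y. (\<integral>\<^sup>+g. ?k y g \<partial>\<nu>) * ?c y \<partial>\<mu>y)"
    by (intro nn_integral_cong nn_integral_multc) measurable
  \<comment> \<open>Orbit invariance is used backwards: replacing y by \<open>act g' y\<close> in
    \<open>x_ratio\<close> makes the integrand a function of \<open>act g' y\<close> times the
    Jacobian, ready for the change of variables.\<close>
  also have "\<dots> = (\<integral>\<^sup>+y. (x_ratio x (act g' y) * cy (act g' y) x') * ennreal (j g' y) \<partial>\<mu>y)"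
    unfolding x_ratio_act
    by (intro nn_integral_cong) (simp add: x_ratio_def orbit_integral_def divide_ennreal_def mult.assoc)
  also have "\<dots> = (\<integral>\<^sup>+y. x_ratio x y * cy y x' \<partial>\<mu>y)"
    by (rule nn_integral_act) measurable
  finally show ?thesis .
qed

text \<open>The integral against \<open>Q\<close> is rewritten through densities on
  \<open>\<nu>\<close> and \<open>\<mu>y\<close>, so that joint measurability in x and y and the use
  of Tonelli become immediate.\<close>

definition Q_cx :: "'x \<Rightarrow> 'y \<Rightarrow> ennreal" where
  "Q_cx x y = (if y \<in> YB then (\<integral>\<^sup>+g. fY (act g y) * ennreal (j g y) / m y * cx x (act g y) \<partial>\<nu>)
     else (\<integral>\<^sup>+y'. fY y' * cx x y' \<partial>\<mu>y))"

lemma Q_cx_measurable[measurable (raw)]: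
  assumes [measurable]: "u \<in> borel_measurable N" "v \<in> borel_measurable N"
  shows "(\<lambda>z. Q_cx (u z) (v z)) \<in> borel_measurable N"
  unfolding Q_cx_def by measurable

lemma nn_integral_Q_cx: "(\<integral>\<^sup>+y'. cx x y' \<partial>Q y) = Q_cx x y"
proof (cases "y \<in> YB")
  case True
  then show ?thesis
    by (simp add: Q_cx_def Q_kernel_def nn_integral_distr nn_integral_density)
next
  case False
  then show ?thesis by (simp add: Q_cx_def Q_kernel_def nn_integral_density)
qed

lemma p_eq: "p x x' = (\<integral>\<^sup>+y. Q_cx x y * cy y x' \<partial>\<mu>y)"
  by (simp add: pstar_x_def nn_integral_Q_cx)

lemma p_measurable[measurable (raw)]:
  assumes [measurable]: "u \<in> borel_measurable N" "v \<in> borel_measurable N"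
  shows "(\<lambda>z. p (u z) (v z)) \<in> borel_measurable N"
  unfolding p_eq by measurable

lemma nn_integral_orbit_density:
  assumes "y \<in> YB" shows "(\<integral>\<^sup>+g. fY (act g y) * ennreal (j g y) / m y \<partial>\<nu>) = 1"
  using m_divide_self[OF assms]
  by (subst nn_integral_divide_ennreal) (auto simp flip: orbit_mass_def)

lemma nn_integral_Q_cx_x: "(\<integral>\<^sup>+x. Q_cx x y \<partial>\<mu>x) = 1"
proof (cases "y \<in> YB")
  case True
  then have "(\<integral>\<^sup>+x. Q_cx x y \<partial>\<mu>x)
    = (\<integral>\<^sup>+g. (\<integral>\<^sup>+x. fY (act g y) * ennreal (j g y) / m y * cx x (act g y) \<partial>\<mu>x) \<partial>\<nu>)"
    unfolding Q_cx_def by (simp, intro XG.Fubini'[symmetric]) measurable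
  then show ?thesis
    using nn_integral_orbit_density[OF True] by (simp add: nn_integral_cmult nn_integral_cx)
next
  case False
  then have "(\<integral>\<^sup>+x. Q_cx x y \<partial>\<mu>x) = (\<integral>\<^sup>+y'. (\<integral>\<^sup>+x. fY y' * cx x y' \<partial>\<mu>x) \<partial>\<mu>y)"
    unfolding Q_cx_def by (simp, intro XY.Fubini'[symmetric]) measurable
  then show ?thesis by (simp add: nn_integral_cmult nn_integral_cx nn_integral_fY)
qed

lemma transition_density_p: "transition_density \<mu>x p"
  unfolding transition_density_def
proof (intro conjI ballI)
  show "(\<lambda>(z, z'). p z z') \<in> borel_measurable (\<mu>x \<Otimes>\<^sub>M \<mu>x)" by measurable
  fix x'
  have "(\<integral>\<^sup>+x. p x x' \<partial>\<mu>x) = (\<integral>\<^sup>+y. (\<integral>\<^sup>+x. Q_cx x y * cy y x' \<partial>\<mu>x) \<partial>\<mu>y)"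
    unfolding p_eq by (intro XY.Fubini'[symmetric]) measurable
  then show "(\<integral>\<^sup>+x. p x x' \<partial>\<mu>x) = 1"
    by (simp add: nn_integral_multc nn_integral_Q_cx_x nn_integral_cy)
qed

text \<open>\<open>fY (act g y)\<close> is a factor of the density of g and the denominator of
  \<open>cx\<close>, and it cancels. The cancellation needs it to be finite, which
  \<open>m y < \<infinity>\<close> ensures for almost every g.\<close>

lemma Q_cx_eq_x_ratio:
  assumes y: "y \<in> YB" shows "AE x in \<mu>x. Q_cx x y = x_ratio x y"
proof -
  have "AE g in \<nu>. fY (act g y) * ennreal (j g y) \<noteq> \<infinity>"
    using y by (intro nn_integral_PInf_AE) (auto simp: Ybar_def orbit_mass_def)
  then have "AE g in \<nu>. AE x in \<mu>x. cx x (act g y) * fY (act g y) = ennreal (f x (act g y))"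
  proof eventually_elim
    case (elim g)
    then have "fY (act g y) < \<infinity>" by (auto simp: ennreal_mult_eq_top_iff less_top)
    then show ?case by (rule cx_mult_fY)
  qed
  \<comment> \<open>The exceptional x depend on g; exchanging the quantifiers by Fubini leaves, for
    almost every x, an exception only on a null set of g.\<close>
  then have "AE x in \<mu>x. AE g in \<nu>. cx x (act g y) * fY (act g y) = ennreal (f x (act g y))"
    by (subst XG.AE_commute) auto
  then show ?thesis
  proof eventually_elim
    case (elim x)
    have "Q_cx x y = (\<integral>\<^sup>+g. ennreal (f x (act g y)) * ennreal (j g y) / m y \<partial>\<nu>)"
    proof -
      have "fY (act g y) * ennreal (j g y) / m y * cx x (act g y)
          = cx x (act g y) * fY (act g y) * ennreal (j g y) / m y" for g
        by (simp add: divide_ennreal_def mult_ac)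
      then have "Q_cx x y = (\<integral>\<^sup>+g. cx x (act g y) * fY (act g y) * ennreal (j g y) / m y \<partial>\<nu>)"
        using y by (simp add: Q_cx_def)
      also have "\<dots> = (\<integral>\<^sup>+g. ennreal (f x (act g y)) * ennreal (j g y) / m y \<partial>\<nu>)"
        using elim by (intro nn_integral_cong_AE) (auto elim!: eventually_mono)
      finally show ?thesis .
    qed
    also have "\<dots> = x_ratio x y"
      using y by (simp add: x_ratio_def orbit_integral_def nn_integral_divide_ennreal)
    finally show ?case .
  qed
qed

lemma nn_integral_P_g_eq_p: "AE x in \<mu>x. (\<integral>\<^sup>+g. P (x, g) (x', g') \<partial>\<nu>) = p x x'"
proof -
  have "AE y in \<mu>y. AE x in \<mu>x. Q_cx x y = x_ratio x y"
    using AE_YB by eventually_elim (rule Q_cx_eq_x_ratio)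
  then have "AE x in \<mu>x. AE y in \<mu>y. Q_cx x y = x_ratio x y"
    by (subst XY.AE_commute) auto
  then show ?thesis
    by eventually_elim (auto simp: nn_integral_P_g p_eq intro!: nn_integral_cong_AE elim!: eventually_mono)
qed

lemma emeasure_kernel_Times_UNIV:
  assumes [measurable]: "A \<in> sets borel"
  shows "emeasure (density_kernel (\<mu>x \<Otimes>\<^sub>M \<nu>) P z') (A \<times> UNIV)
    = (\<integral>\<^sup>+x\<in>A. (\<integral>\<^sup>+g. P (x, g) z' \<partial>\<nu>) \<partial>\<mu>x)"
proof -
  have "emeasure (density_kernel (\<mu>x \<Otimes>\<^sub>M \<nu>) P z') (A \<times> UNIV)
    = (\<integral>\<^sup>+z. P z z' * indicator (A \<times> UNIV) z \<partial>(\<mu>x \<Otimes>\<^sub>M \<nu>))"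
    unfolding density_kernel_def
    by (intro emeasure_density P_measurable_fst pair_measureI) (simp_all add: sets_x sets_g)
  also have "\<dots> = (\<integral>\<^sup>+x. (\<integral>\<^sup>+g. P (x, g) z' * indicator (A \<times> UNIV) (x, g) \<partial>\<nu>) \<partial>\<mu>x)"
    by (intro G.nn_integral_fst[symmetric] borel_measurable_times_ennreal P_measurable_fst) measurable
  also have "\<dots> = (\<integral>\<^sup>+x\<in>A. (\<integral>\<^sup>+g. P (x, g) z' \<partial>\<nu>) \<partial>\<mu>x)"
    by (intro nn_integral_cong) (auto split: split_indicator)
  finally show ?thesis .
qed

text \<open>The lumpability criterion: the probability of moving into a cylinder depends on the
  first coordinate alone. It holds for every \<open>z'\<close>, as integration over \<open>A\<close>
  ignores the exceptional x.\<close>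

lemma emeasure_kernel_marginal:
  assumes [measurable]: "A \<in> sets borel"
  shows "emeasure (density_kernel (\<mu>x \<Otimes>\<^sub>M \<nu>) P z') (A \<times> UNIV)
    = emeasure (density_kernel \<mu>x p (fst z')) A"
proof -
  have "(\<integral>\<^sup>+x\<in>A. (\<integral>\<^sup>+g. P (x, g) z' \<partial>\<nu>) \<partial>\<mu>x) = (\<integral>\<^sup>+x\<in>A. p x (fst z') \<partial>\<mu>x)"
    using nn_integral_P_g_eq_p[of "fst z'" "snd z'"]
    by (intro nn_integral_cong_AE) (auto elim!: eventually_mono)
  also have "\<dots> = emeasure (density_kernel \<mu>x p (fst z')) A"
    unfolding density_kernel_def by (rule emeasure_density[symmetric]) measurable
  finally show ?thesis using emeasure_kernel_Times_UNIV[OF assms] by simp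
qed

lemma markov_chain_marginal:
  fixes M :: "'w measure"
  assumes mc: "markov_chain M borel (density_kernel (\<mu>x \<Otimes>\<^sub>M \<nu>) P) (\<lambda>n \<omega>. (X n \<omega>, G n \<omega>))"
  shows "conditional_density M \<mu>x borel (X (Suc n)) (\<lambda>\<omega>. (X n \<omega>, G n \<omega>)) (\<lambda>x z'. \<integral>\<^sup>+g. P (x, g) z' \<partial>\<nu>)"
    and "markov_chain M borel (density_kernel \<mu>x p) X"
proof -
  let ?Z = "\<lambda>n \<omega>. (X n \<omega>, G n \<omega>)"
  have Z: "?Z n \<in> measurable M borel" for n
    using mc by (simp add: markov_chain_def)
  have fst_borel: "fst \<in> measurable (borel :: ('x \<times> 'g) measure) borel"
    unfolding borel_prod[symmetric] by measurable
  have X: "X n \<in> measurable M borel" for n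
    using measurable_compose[OF Z fst_borel] by simp
  have preimage: "?Z n -` (A \<times> UNIV) \<inter> space M = X n -` A \<inter> space M" for n A
    by auto
  have A_UNIV: "A \<times> UNIV \<in> sets (borel :: ('x \<times> 'g) measure)" if "A \<in> sets borel" for A
    using that unfolding borel_prod[symmetric] by measurable
  show "conditional_density M \<mu>x borel (X (Suc n)) (?Z n) (\<lambda>x z'. \<integral>\<^sup>+g. P (x, g) z' \<partial>\<nu>)"
    unfolding conditional_density_def
  proof (intro conjI ballI)
    have q: "(\<lambda>(u, v). \<integral>\<^sup>+g. P (u, g) v \<partial>\<nu>) \<in> borel_measurable (\<mu>x \<Otimes>\<^sub>M (borel \<Otimes>\<^sub>M borel))"
      by measurable
    then show "(\<lambda>(u, v). \<integral>\<^sup>+g. P (u, g) v \<partial>\<nu>) \<in> borel_measurable (\<mu>x \<Otimes>\<^sub>M borel)"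
      unfolding borel_prod .
    fix A assume "A \<in> sets \<mu>x"
    then have A: "A \<in> sets borel" by (simp add: sets_x)
    note this[measurable]
    let ?F = "vimage_algebra (space M) (?Z n) borel"
    let ?q = "\<lambda>z'. \<integral>\<^sup>+x\<in>A. (\<integral>\<^sup>+g. P (x, g) z' \<partial>\<nu>) \<partial>\<mu>x"
    have "?q \<in> borel_measurable (borel \<Otimes>\<^sub>M borel)" by measurable
    then have "?q \<in> borel_measurable borel" unfolding borel_prod .
    then have "(\<lambda>\<omega>. ?q (?Z n \<omega>)) \<in> borel_measurable ?F"
      by (rule measurable_compose[rotated]) (rule measurable_vimage_algebra1, use measurable_space[OF Z] in auto)
    then show "AE \<omega> in M. nn_cond_exp M ?F (indicator (X (Suc n) -` A \<inter> space M)) \<omega> = ?q (?Z n \<omega>)"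
      using markov_chain_nn_cond_exp[OF mc A_UNIV[OF A] subalgebra_vimage_algebra[OF Z]
          sets_vimage_algebra_subset_history[of ?Z, OF Z]]
      by (simp add: preimage emeasure_kernel_Times_UNIV[OF A])
  qed
  show "markov_chain M borel (density_kernel \<mu>x p) X"
    unfolding markov_chain_def
  proof (intro conjI allI ballI)
    show "prob_space M" using mc by (simp add: markov_chain_def)
    show "X n \<in> measurable M borel" for n by (rule X)
    fix n and A :: "'x set" assume A: "A \<in> sets borel"
    note this[measurable]
    let ?q = "\<lambda>x. emeasure (density_kernel \<mu>x p x) A"
    have "(\<lambda>x. \<integral>\<^sup>+u. p u x * indicator A u \<partial>\<mu>x) \<in> borel_measurable borel" by measurable
    moreover have "?q x = (\<integral>\<^sup>+u. p u x * indicator A u \<partial>\<mu>x)" for x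
      unfolding density_kernel_def by (rule emeasure_density) measurable
    ultimately have "?q \<in> borel_measurable borel" by simp
    then have "(\<lambda>\<omega>. ?q (X n \<omega>)) \<in> borel_measurable (history M borel X n)"
      by (rule measurable_compose[OF measurable_history[OF X order_refl]])
    \<comment> \<open>The past of X is coarser than the past of the pair, yet by lumpability the
      transition probability into a cylinder is measurable for it, so the tower property
      applies.\<close>
    then show "AE \<omega> in M. nn_cond_exp M (history M borel X n) (indicator (X (Suc n) -` A \<inter> space M)) \<omega> = ?q (X n \<omega>)"
      using markov_chain_nn_cond_exp[OF mc A_UNIV[OF A] subalgebra_history[OF X]]
        sets_history_comp_subset[where Z="?Z" and n=n, OF fst_borel Z]
      by (simp add: preimage emeasure_kernel_marginal[OF A])
  qed
qed

end

theorem mainTheorem4: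
  fixes \<mu>x :: "'x::{metric_space, second_countable_topology} measure"
    and \<mu>y :: "'y::{metric_space, second_countable_topology} measure"
    and \<nu> :: "'g::{metric_space, second_countable_topology, topological_group_add} measure"
    and f :: "'x \<Rightarrow> 'y \<Rightarrow> real" and \<phi>x :: "'x \<Rightarrow> real" and \<phi>y :: "'y \<Rightarrow> real"
    and act :: "'g \<Rightarrow> 'y \<Rightarrow> 'y" and j :: "'g \<Rightarrow> 'y \<Rightarrow> real"
  defines "fX \<equiv> marginal_x \<mu>y f"
    and "m \<equiv> orbit_mass \<mu>x f act j \<nu>"
    and "YB \<equiv> Ybar \<mu>x f act j \<nu>"
    and "fh \<equiv> fhat f act j"
    and "P \<equiv> pstar_xg \<mu>x \<mu>y f \<phi>y act j \<nu>"
    and "p \<equiv> pstar_x \<mu>x \<mu>y f \<phi>x \<phi>y act j \<nu>"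
  assumes "locally compact (UNIV :: 'x set)"
    and "locally compact (UNIV :: 'y set)"
    and "locally compact (UNIV :: 'g set)"
    and "sets \<mu>x = sets borel" and "sigma_finite_measure \<mu>x"
    and "sets \<mu>y = sets borel" and "sigma_finite_measure \<mu>y"
    and "prob_density (\<mu>x \<Otimes>\<^sub>M \<mu>y) (\<lambda>(x, y). f x y)"
    and "prob_density \<mu>x \<phi>x" and "prob_density \<mu>y \<phi>y"
    and "topological_left_action act"
    and "action_jacobian \<mu>y act j"
    and "left_haar_measure \<nu>"
    and "emeasure \<nu> UNIV = \<infinity>"
    and "\<forall>y. 0 < m y"
    and "AE y in \<mu>y. m y < \<infinity>"
  shows
    "(\<integral>\<^sup>+g. (\<integral>\<^sup>+y. (\<integral>\<^sup>+x. ennreal (fh x y g) \<partial>\<mu>x) \<partial>\<mu>y) \<partial>\<nu>) = emeasure \<nu> UNIV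
     \<and> emeasure \<nu> UNIV = \<infinity>
     \<and> \<not> (\<exists>c. prob_density (\<mu>x \<Otimes>\<^sub>M (\<mu>y \<Otimes>\<^sub>M \<nu>)) (\<lambda>(x, y, g). c * fh x y g))
     \<and> (\<forall>x y g. fhat_y_given_xg \<mu>y f act j \<phi>y y (x, g)
           = cond_y_given_x \<mu>y f \<phi>y (act g y) x * ennreal (j g y))
     \<and> (\<forall>x g. \<forall>y\<in>YB. fhat_xg_given_y \<mu>x f act j \<nu> (x, g) y
           = ennreal (f x (act g y) * j g y) / m y)
     \<and> transition_density (\<mu>x \<Otimes>\<^sub>M \<nu>) P
     \<comment> \<open>(a)\<close>
     \<and> invariant_measure borel (density_kernel (\<mu>x \<Otimes>\<^sub>M \<nu>) P) (density \<mu>x fX \<Otimes>\<^sub>M \<nu>)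
     \<and> emeasure (density \<mu>x fX \<Otimes>\<^sub>M \<nu>) UNIV = emeasure \<nu> UNIV
     \<and> \<not> positive_recurrent borel (density_kernel (\<mu>x \<Otimes>\<^sub>M \<nu>) P)
     \<comment> \<open>(b)\<close>
     \<and> (\<forall>x' g'. AE x in \<mu>x. (\<integral>\<^sup>+g. P (x, g) (x', g') \<partial>\<nu>) = p x x')
     \<and> transition_density \<mu>x p
     \<and> (\<forall>(M :: 'w measure) (X :: nat \<Rightarrow> 'w \<Rightarrow> 'x) (G :: nat \<Rightarrow> 'w \<Rightarrow> 'g).
       markov_chain M borel (density_kernel (\<mu>x \<Otimes>\<^sub>M \<nu>) P) (\<lambda>n \<omega>. (X n \<omega>, G n \<omega>)) \<longrightarrow>
         (\<forall>n. conditional_density M \<mu>x borel (X (Suc n)) (\<lambda>\<omega>. (X n \<omega>, G n \<omega>))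
                (\<lambda>x z'. \<integral>\<^sup>+g. P (x, g) z' \<partial>\<nu>))
         \<and> markov_chain M borel (density_kernel \<mu>x p) X)"
proof -
  interpret haar_pxda \<mu>x \<mu>y \<nu> f \<phi>x \<phi>y act j
    using assms by (auto simp: haar_pxda_def haar_pxda_axioms_def)
  show ?thesis
    unfolding fX_def m_def YB_def fh_def P_def p_def
    using nn_integral_fhat fhat_not_normalizable[OF \<open>emeasure \<nu> UNIV = \<infinity>\<close>] \<open>emeasure \<nu> UNIV = \<infinity>\<close>
      fhat_y_given_xg_eq fhat_xg_given_y_eq transition_density_P invariant_P emeasure_invariant
      not_positive_recurrent_P[OF \<open>emeasure \<nu> UNIV = \<infinity>\<close>] nn_integral_P_g_eq_p
      transition_density_p markov_chain_marginal
    by (intro conjI allI ballI impI) auto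
qed

end
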